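(* Let $G$ be a minimal non-$4$-choosable planar graph, embedded in the plane, and let $v$ be a vertex of degree $6$ in $G$. Then at least two of the faces incident to $v$ are each incident to at least two vertices of degree at least $5$.
   Context: All graphs are finite, simple and undirected. A graph is $4$-choosable if for every assignment of lists of size $4$ to its vertices there is a proper coloring choosing each vertex's color from its list. A minimal non-$4$-choosable planar graph is a planar graph that is not $4$-choosable and has the minimum number of vertices among such graphs. A face is incident to a vertex if the vertex lies on its boundary. *)

theory Defs
  imports "HOL-Analysis.Analysis"
begin

text \<open>A graph is given by its vertex set and its set of edges, an edge being a two-element
  set of vertices.\<close>

definition simple_graph :: "'a set \<Rightarrow> 'a set set \<Rightarrow> bool" where
  "simple_graph V E \<longleftrightarrow> finite V \<and> (\<forall>e\<in>E. e \<subseteq> V \<and> card e = 2)"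

definition vdegree :: "'a set set \<Rightarrow> 'a \<Rightarrow> nat" where
  "vdegree E v = card {e \<in> E. v \<in> e}"

definition proper_coloring :: "'a set set \<Rightarrow> ('a \<Rightarrow> 'c) \<Rightarrow> bool" where
  "proper_coloring E c \<longleftrightarrow> (\<forall>u w. {u, w} \<in> E \<longrightarrow> c u \<noteq> c w)"

text \<open>Colors are natural numbers: only finitely many colors occur in the lists of a finite graph,
  so an infinite supply of colors of any kind gives the same notion.\<close>

definition choosable :: "nat \<Rightarrow> 'a set \<Rightarrow> 'a set set \<Rightarrow> bool" where
  "choosable k V E \<longleftrightarrow>
     (\<forall>L :: 'a \<Rightarrow> nat set. (\<forall>v\<in>V. finite (L v) \<and> card (L v) = k) \<longrightarrow>
        (\<exists>c. (\<forall>v\<in>V. c v \<in> L v) \<and> proper_coloring E c))"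

text \<open>The plane is \<^typ>\<open>complex\<close>. Vertices are placed by \<open>pos\<close>, and the edge \<open>e\<close> is drawn as the
  Jordan arc \<open>\<gamma> e\<close>, whose orientation is irrelevant. An arc meets vertices only at its ends, and
  distinct arcs meet only at common ends.\<close>

definition plane_embedding ::
  "'a set \<Rightarrow> 'a set set \<Rightarrow> ('a \<Rightarrow> complex) \<Rightarrow> ('a set \<Rightarrow> real \<Rightarrow> complex) \<Rightarrow> bool" where
  "plane_embedding V E pos \<gamma> \<longleftrightarrow>
     inj_on pos V \<and>
     (\<forall>e\<in>E. arc (\<gamma> e) \<and> {pathstart (\<gamma> e), pathfinish (\<gamma> e)} = pos ` e \<and>
             path_image (\<gamma> e) \<inter> pos ` V = pos ` e) \<and>
     (\<forall>e\<in>E. \<forall>e'\<in>E. e \<noteq> e' \<longrightarrow> path_image (\<gamma> e) \<inter> path_image (\<gamma> e') = pos ` (e \<inter> e'))"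

definition planar :: "'a set \<Rightarrow> 'a set set \<Rightarrow> bool" where
  "planar V E \<longleftrightarrow> (\<exists>pos \<gamma>. plane_embedding V E pos \<gamma>)"

definition drawing ::
  "'a set \<Rightarrow> 'a set set \<Rightarrow> ('a \<Rightarrow> complex) \<Rightarrow> ('a set \<Rightarrow> real \<Rightarrow> complex) \<Rightarrow> complex set" where
  "drawing V E pos \<gamma> = pos ` V \<union> (\<Union>e\<in>E. path_image (\<gamma> e))"

text \<open>The unbounded component is a face as well.\<close>

definition faces ::
  "'a set \<Rightarrow> 'a set set \<Rightarrow> ('a \<Rightarrow> complex) \<Rightarrow> ('a set \<Rightarrow> real \<Rightarrow> complex) \<Rightarrow> complex set set" where
  "faces V E pos \<gamma> = components (- drawing V E pos \<gamma>)"

definition face_incident :: "('a \<Rightarrow> complex) \<Rightarrow> complex set \<Rightarrow> 'a \<Rightarrow> bool" where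
  "face_incident pos F v \<longleftrightarrow> pos v \<in> frontier F"

text \<open>Minimality is with respect to the number of vertices. The competitors range over graphs on
  natural numbers, which include a copy of every finite graph, whatever the vertex type of the
  given one.\<close>

definition minimal_non_choosable_planar :: "nat \<Rightarrow> 'a set \<Rightarrow> 'a set set \<Rightarrow> bool" where
  "minimal_non_choosable_planar k V E \<longleftrightarrow>
     simple_graph V E \<and> planar V E \<and> \<not> choosable k V E \<and>
     (\<forall>(W :: nat set) D. simple_graph W D \<and> planar W D \<and> \<not> choosable k W D
        \<longrightarrow> card V \<le> card W)"

end

theory Submission
  imports Defs "HOL-Complex_Analysis.Complex_Analysis"
begin

text \<open>Fix lists witnessing that \<open>G\<close> is not 4-choosable. Every coloring of a proper part of \<open>G\<close>
  from the lists extends greedily over a connected set of vertices of degree 4 as soon as one of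
  them has a spare color. Suppose that a part \<open>C\<close> of \<open>G - v\<close> is joined to the rest only through \<open>v\<close>,
  and that the neighbors of \<open>v\<close> in \<open>C\<close> lie in a connected set \<open>S\<close> of vertices of degree 4. If such a
  neighbor \<open>u\<close> has a neighbor \<open>p\<close> outside \<open>S \<union> {v}\<close>, then the colors that \<open>p\<close> can take in \<open>C - S\<close> and
  those that \<open>v\<close> can take outside \<open>C\<close> are disjoint subsets of the list of \<open>u\<close>; identifying \<open>p\<close> with \<open>v\<close>
  along the path \<open>p u v\<close>, after renaming colors, gives a smaller planar graph that is not
  4-choosable. Taking \<open>S\<close> minimal leaves only configurations containing a (subdivided) \<open>K\<^sub>5\<close>, a bridge,
  or a cubic graph on the six neighbors of \<open>v\<close>, all of which are reducible.

  Hence, if \<open>K\<^sub>0\<close> is the set of vertices reachable from a neighbor \<open>x\<close> of \<open>v\<close> through vertices of degree 4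
  (or \<open>{x}\<close> if \<open>x\<close> is large) and \<open>R\<close> is the component of \<open>v\<close> in \<open>G - K\<^sub>0\<close>, there is an edge between
  \<open>K\<^sub>0\<close> and \<open>R - v\<close>, and every such edge has an end of degree at least 5. The drawings of \<open>R\<close> and of the
  remaining vertices together with \<open>v\<close> are connected and meet only in \<open>v\<close>, so an edge between
  them closes a Jordan curve through \<open>v\<close>. By Janiszewski's theorem each side of this curve contains a
  face that is incident to \<open>v\<close> and bounded by a whole such edge.\<close>

section \<open>Arcs and complementary domains in the plane\<close>

lemma arc_small_piece:
  fixes g :: "real \<Rightarrow> complex"
  assumes "arc g" "0 < m" "m < 1" "e > 0"
  obtains u v where "0 < u" "u < m" "m < v" "v < 1" "g ` {u..v} \<subseteq> ball (g m) e"
proof -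
  have "continuous_on {0..1} g"
    using assms(1) by (simp add: arc_def path_def)
  then obtain d where "d > 0" and d: "\<And>x. x \<in> {0..1} \<Longrightarrow> dist x m < d \<Longrightarrow> dist (g x) (g m) < e"
    using assms by (metis atLeastAtMost_iff continuous_on_iff less_imp_le)
  define \<delta> where "\<delta> = Min {d/2, m/2, (1-m)/2}"
  have \<delta>: "\<delta> > 0" "\<delta> < d" "\<delta> < m" "\<delta> < 1 - m"
    using assms \<open>d > 0\<close> by (auto simp: \<delta>_def min_def)
  show thesis
  proof
    show "g ` {m - \<delta>..m + \<delta>} \<subseteq> ball (g m) e"
    proof
      fix y assume "y \<in> g ` {m - \<delta>..m + \<delta>}"
      then obtain x where "y = g x" "m - \<delta> \<le> x" "x \<le> m + \<delta>" by auto
      then show "y \<in> ball (g m) e"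
        using d[of x] \<delta> by (auto simp: dist_commute dist_real_def abs_if)
    qed
  qed (use \<delta> in auto)
qed

lemma arc_split_image:
  assumes "0 < u" "u < v" "v < 1"
  shows "path_image g = g ` {0..u} \<union> g ` {u..v} \<union> g ` {v..1}"
proof -
  have "{0..1} = {0..u} \<union> {u..v} \<union> {v..1::real}"
    using assms by auto
  then show ?thesis
    by (simp add: path_image_def image_Un)
qed

lemma arc_piece:
  fixes g :: "real \<Rightarrow> complex"
  assumes "arc g" "0 \<le> u" "u < v" "v \<le> 1"
  shows "compact (g ` {u..v})" "connected (g ` {u..v})" "connected (- g ` {u..v})"
proof -
  have "arc (subpath u v g)" "path_image (subpath u v g) = g ` {u..v}"
    using assms by (auto simp: arc_subpath_arc path_image_subpath)
  then show "compact (g ` {u..v})" "connected (g ` {u..v})" "connected (- g ` {u..v})"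
    by (metis compact_arc_image connected_arc_image connected_arc_complement DIM_complex order_refl)+
qed

lemma arc_image_notin:
  assumes "arc g" "0 \<le> m" "m \<le> 1" "A \<subseteq> {0..1}" "m \<notin> A"
  shows "g m \<notin> g ` A"
  using assms inj_on_image_mem_iff[of g "{0..1}" m A] by (simp add: arc_def)

lemma arc_interior_notin:
  assumes "arc g" "path_image g \<inter> X \<subseteq> {pathstart g, pathfinish g}" "0 < m" "m < 1"
  shows "g m \<notin> X"
proof -
  have "g m \<notin> g ` {0,1}"
    by (rule arc_image_notin) (use assms in auto)
  moreover have "g m \<in> path_image g"
    using assms by (auto simp: path_image_def)
  ultimately show ?thesis
    using assms(2) by (auto simp: pathstart_def pathfinish_def)
qed

text \<open>Both end pieces of the arc are themselves arcs, which do not separate the plane, and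
  each meets what has been removed before it in at most one point. So two applications of
  Janiszewski's theorem add them to \<open>X\<close> without separating \<open>a\<close> from
  \<open>b\<close>.\<close>

lemma connected_component_minus_arc_ends:
  fixes X :: "complex set"
  assumes "compact X" "arc g" "path_image g \<inter> X \<subseteq> {pathstart g, pathfinish g}"
    and uv: "0 < u" "u < v" "v < 1"
    and "connected_component (- X) a b"
    and "a \<notin> g ` {0..u} \<union> g ` {v..1}" "b \<notin> g ` {0..u} \<union> g ` {v..1}"
  shows "connected_component (- (X \<union> (g ` {0..u} \<union> g ` {v..1}))) a b"
proof -
  note p1 = arc_piece[OF assms(2), of 0 u] and p2 = arc_piece[OF assms(2), of v 1]
  have cc: "connected_component (- g ` {0..u}) a b" "connected_component (- g ` {v..1}) a b"
    using p1 p2 assms by (auto simp: connected_iff_connected_component)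
  have n1: "g 1 \<notin> g ` {0..u}" "g 0 \<notin> g ` {v..1}"
    by (rule arc_image_notin; use assms in auto)+
  have disj: "g ` {0..u} \<inter> g ` {v..1} = {}"
  proof -
    have "{0..u} \<inter> {v..1} = {}" using uv by auto
    moreover have "inj_on g {0..1}" using assms(2) by (simp add: arc_def)
    ultimately show ?thesis using uv
      using inj_on_image_Int[of g "{0..1}" "{0..u}" "{v..1}"] by auto
  qed
  have s: "g ` {0..u} \<subseteq> path_image g" "g ` {v..1} \<subseteq> path_image g"
    using uv by (auto simp: path_image_def)
  have ends: "z = g 0 \<or> z = g 1" if "z \<in> path_image g" "z \<in> X" for z
    using assms(3) that by (auto simp: pathstart_def pathfinish_def)
  have i1: "g ` {0..u} \<inter> X \<subseteq> {g 0}"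
  proof
    fix z assume z: "z \<in> g ` {0..u} \<inter> X"
    then have "z = g 0 \<or> z = g 1" using ends s(1) by (meson IntD1 IntD2 subsetD)
    then show "z \<in> {g 0}" using n1(1) z by (metis IntD1 singletonI)
  qed
  have i2: "g ` {v..1} \<inter> (g ` {0..u} \<union> X) \<subseteq> {g 1}"
  proof
    fix z assume z: "z \<in> g ` {v..1} \<inter> (g ` {0..u} \<union> X)"
    then have "z \<in> X" using disj by (metis Int_iff Un_iff emptyE)
    then have "z = g 0 \<or> z = g 1" using ends s(2) z by (meson IntD1 subsetD)
    then show "z \<in> {g 1}" using n1(2) z by (metis IntD1 singletonI)
  qed
  have "connected_component (- (g ` {0..u} \<union> X)) a b"
  proof (rule Janiszewski)
    show "compact (g ` {0..u})" using p1 uv by auto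
    show "closed X" using assms(1) compact_imp_closed by auto
    show "connected (g ` {0..u} \<inter> X)" using i1 by (metis connected_empty connected_sing subset_singletonD)
  qed (use cc assms in auto)
  then have "connected_component (- (g ` {v..1} \<union> (g ` {0..u} \<union> X))) a b"
  proof (rule Janiszewski[rotated -1])
    show "compact (g ` {v..1})" using p2 uv by auto
    show "closed (g ` {0..u} \<union> X)" using p1 uv assms(1) compact_imp_closed compact_Un by force
    show "connected (g ` {v..1} \<inter> (g ` {0..u} \<union> X))" using i2 by (metis connected_empty connected_sing subset_singletonD)
  qed (use cc in auto)
  then show ?thesis
    by (simp add: Un_ac)
qed

lemma arc_interior_dense:
  fixes g :: "real \<Rightarrow> complex"
  assumes "arc g" "closed S" "\<And>m. 0 < m \<Longrightarrow> m < 1 \<Longrightarrow> g m \<in> S"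
  shows "path_image g \<subseteq> S"
proof -
  have "g ` closure {0<..<1} \<subseteq> S"
    using assms by (intro image_closure_subset) (auto simp: arc_def path_def)
  then show ?thesis
    by (simp add: path_image_def)
qed

text \<open>Suppose a disc around \<open>g m\<close> missed \<open>W\<close>. Leaving a short gap in
  the arc inside this disc, the two end pieces do not separate \<open>w\<close> from
  \<open>g m\<close>. A connected set joining these points leaves \<open>W\<close> through its
  frontier, hence inside the gap and so inside the disc, which is impossible.\<close>

lemma arc_subset_closure_component:
  fixes X :: "complex set"
  assumes "compact X" "arc g" "path_image g \<inter> X \<subseteq> {pathstart g, pathfinish g}"
    and W: "W \<in> components (- (X \<union> path_image g))" and w: "w \<in> W"
    and "connected_component (- X) w (g m0)" "0 < m0" "m0 < 1"
  shows "path_image g \<subseteq> closure W"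
proof (rule arc_interior_dense[OF assms(2) closed_closure])
  fix m :: real assume m: "0 < m" "m < 1"
  note nX = arc_interior_notin[OF assms(2,3)]
  have "connected (g ` {0<..<1})"
    using assms(2) by (intro connected_continuous_image) (auto simp: arc_def path_def elim: continuous_on_subset)
  then have "connected_component (- X) (g m0) (g m)"
    unfolding connected_component_def using nX m assms by (intro exI[of _ "g ` {0<..<1}"]) auto
  then have cm: "connected_component (- X) w (g m)"
    using assms(6) connected_component_trans by blast
  have wn: "w \<notin> X \<union> path_image g" 
    using W w in_components_subset by blast
  show "g m \<in> closure W"
  proof (rule ccontr)
    assume "g m \<notin> closure W"
    then obtain e where "e > 0" and e': "\<forall>y\<in>W. \<not> dist y (g m) < e"
      by (auto simp: closure_approachable)
    then have e: "ball (g m) e \<inter> W = {}"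
      by (auto simp: dist_commute)
    obtain u v where uv: "0 < u" "u < m" "m < v" "v < 1" and gb: "g ` {u..v} \<subseteq> ball (g m) e"
      using arc_small_piece[OF assms(2) m \<open>e > 0\<close>] by blast
    have gm: "g m \<notin> g ` {0..u}" "g m \<notin> g ` {v..1}"
      by (rule arc_image_notin[OF assms(2)]; use uv in auto)+
    have "connected_component (- (X \<union> (g ` {0..u} \<union> g ` {v..1}))) w (g m)"
      by (rule connected_component_minus_arc_ends)
         (use assms cm gm wn uv in \<open>auto simp: path_image_def\<close>)
    then obtain T where T: "connected T" "T \<subseteq> - (X \<union> (g ` {0..u} \<union> g ` {v..1}))" "w \<in> T" "g m \<in> T"
      unfolding connected_component_def by blast
    have "g m \<notin> W" using \<open>g m \<notin> closure W\<close> closure_subset by blast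
    then have "T \<inter> frontier W \<noteq> {}"
      using connected_Int_frontier[OF T(1), of W] T w by auto
    then obtain z where z: "z \<in> T" "z \<in> frontier W" by blast
    have "frontier W \<subseteq> X \<union> path_image g"
    proof -
      have "frontier W \<subseteq> frontier (- (X \<union> path_image g))"
        using W assms(1,2) by (intro frontier_of_components_subset)
      also have "\<dots> \<subseteq> X \<union> path_image g"
        using assms(1,2) by (metis compact_Un compact_arc_image compact_imp_closed frontier_complement frontier_subset_closed)
      finally show ?thesis .
    qed
    then have "z \<in> X \<union> (g ` {0..u} \<union> g ` {u..v} \<union> g ` {v..1})"
      using z(2) arc_split_image[of u v g] uv by auto
    moreover have "z \<notin> X \<union> (g ` {0..u} \<union> g ` {v..1})"
      using z(1) T(2) by (meson ComplD subsetD)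
    ultimately have "z \<in> g ` {u..v}"
      by (meson UnE UnI1 UnI2)
    then have "z \<in> ball (g m) e" using gb by blast
    moreover have "z \<in> closure W" using z by (simp add: frontier_def)
    ultimately show False
      using e open_Int_closure_eq_empty[of "ball (g m) e" W] by auto
  qed
qed

text \<open>Near an interior point of \<open>g\<close> only \<open>g\<close> itself can separate.
  Janiszewski's theorem is applied to \<open>J\<close> and to the union of \<open>X\<close>,
  \<open>r\<close> and the two end pieces of \<open>g\<close>; these sets meet in \<open>r\<close>
  with the end pieces attached, a connected set because \<open>r\<close> contains both ends of
  \<open>g\<close>.\<close>

lemma same_side_not_separated:
  fixes X J :: "complex set"
  assumes "compact X" "arc g" "path_image g \<inter> X \<subseteq> {pathstart g, pathfinish g}"
    and r: "compact r" "connected r" "J = path_image g \<union> r"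
      "path_image g \<inter> r = {pathstart g, pathfinish g}"
    and m: "0 < m" "m < 1"
  obtains e where "e > 0"
    "\<And>s s'. s \<in> ball (g m) e \<Longrightarrow> s' \<in> ball (g m) e \<Longrightarrow> connected_component (- J) s s'
        \<Longrightarrow> connected_component (- (X \<union> path_image g)) s s'"
proof -
  have "g m \<notin> X \<union> r"
    using arc_interior_notin[OF assms(2,3) m] arc_interior_notin[OF assms(2) _ m, of r] r(4) by auto
  moreover have "closed (X \<union> r)"
    using assms(1) r compact_imp_closed by blast
  ultimately obtain d where "d > 0" and d: "ball (g m) d \<subseteq> - (X \<union> r)"
    by (metis ComplI open_Compl open_contains_ball)
  obtain u v where uv: "0 < u" "u < m" "m < v" "v < 1"
    using m dense by meson
  let ?E = "g ` {0..u} \<union> g ` {v..1}"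
  have gm: "g m \<notin> g ` {0..u}" "g m \<notin> g ` {v..1}"
    by (rule arc_image_notin[OF assms(2)]; use uv in auto)+
  have cE: "compact ?E"
    using arc_piece[OF assms(2), of 0 u] arc_piece[OF assms(2), of v 1] uv by auto
  then obtain d' where "d' > 0" and d': "ball (g m) d' \<subseteq> - ?E"
    by (metis gm ComplI Un_iff compact_imp_closed open_Compl open_contains_ball)
  show thesis
  proof
    show "min d d' > 0" using \<open>d > 0\<close> \<open>d' > 0\<close> by auto
    fix s s' assume s: "s \<in> ball (g m) (min d d')" "s' \<in> ball (g m) (min d d')"
      and J: "connected_component (- J) s s'"
    \<comment> \<open>The middle of \<open>g\<close> is left out of \<open>?B\<close>, so a small
      disc about \<open>g m\<close> avoids \<open>?B\<close> and joins \<open>s\<close> to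
      \<open>s'\<close> there; \<open>J\<close> supplies the middle again.\<close>
    let ?B = "X \<union> r \<union> ?E"
    have sub: "ball (g m) (min d d') \<subseteq> - ?B"
      using d d' by auto
    have "connected_component (- (J \<union> ?B)) s s'"
    proof (rule Janiszewski)
      show "compact J" using r assms(2) by (simp add: compact_Un compact_arc_image)
      show "closed ?B" using assms(1) r(1) cE compact_imp_closed by blast
      have "J \<inter> ?B = r \<union> g ` {0..u} \<union> g ` {v..1}"
        using assms(3) r(3,4) uv by (auto simp: path_image_def)
      moreover have "connected (r \<union> g ` {0..u} \<union> g ` {v..1})"
      proof -
        have "pathstart g \<in> r \<inter> g ` {0..u}" "pathfinish g \<in> (r \<union> g ` {0..u}) \<inter> g ` {v..1}"
          using r(4) uv by (auto simp: pathstart_def pathfinish_def)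
        moreover have "connected (g ` {0..u})" "connected (g ` {v..1})"
          using arc_piece[OF assms(2), of 0 u] arc_piece[OF assms(2), of v 1] uv by auto
        ultimately show ?thesis
          using r(2) by (intro connected_Un) auto
      qed
      ultimately show "connected (J \<inter> ?B)" by simp
      show "connected_component (- J) s s'" by fact
      show "connected_component (- ?B) s s'"
        unfolding connected_component_def using sub s connected_ball by blast
    qed
    then show "connected_component (- (X \<union> path_image g)) s s'"
      by (rule connected_component_of_subset) (use r(3) in auto)
  qed
qed

text \<open>If \<open>w\<close> were away from \<open>W\<close>, the frontier of \<open>W\<close>
  would meet \<open>P\<close> and \<open>Q\<close> in two disjoint compact sets, each touching
  \<open>g\<close> in at most one end. By Janiszewski's theorem these sets and \<open>g\<close>
  together do not separate points close to \<open>g m\<close>, although the frontier of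
  \<open>W\<close> lies in their union and there are points both of \<open>W\<close> and outside
  \<open>W\<close> near \<open>g m\<close>.\<close>

lemma base_face_touches:
  fixes P Q :: "complex set"
  assumes "compact P" "compact Q" "P \<inter> Q = {w}" "arc g"
    and gP: "path_image g \<inter> P = {pathstart g}" and gQ: "path_image g \<inter> Q = {pathfinish g}"
    and W: "W \<in> components (- (P \<union> Q \<union> path_image g))"
    and m: "0 < m" "m < 1" and near: "g m \<in> closure W" "g m \<in> closure (- (W \<union> path_image g))"
  shows "w \<in> closure W"
proof (rule ccontr)
  assume w: "w \<notin> closure W"
  have gm: "g m \<notin> P \<union> Q"
    using arc_interior_notin[OF assms(4) _ m, of "P \<union> Q"] gP gQ by (simp add: Int_Un_distrib)
  have "closed (P \<union> Q)" using assms(1,2) compact_imp_closed by blast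
  then obtain e where "e > 0" and e: "ball (g m) e \<subseteq> - (P \<union> Q)"
    by (metis gm ComplI open_Compl open_contains_ball)
  obtain s where s: "s \<in> W" "s \<in> ball (g m) e"
    using near(1) \<open>e > 0\<close> by (metis closure_approachable dist_commute mem_ball)
  obtain t where t: "t \<notin> W" "t \<notin> path_image g" "t \<in> ball (g m) e"
    using near(2) \<open>e > 0\<close> by (metis closure_approachable dist_commute mem_ball ComplD UnCI)
  have sn: "s \<notin> path_image g" using W s in_components_subset by fastforce
  define X where "X = frontier W \<inter> P"
  define Y where "Y = frontier W \<inter> Q"
  have XY: "compact X" "compact Y" "X \<inter> Y = {}"
  proof -
    show "compact X" "compact Y"
      unfolding X_def Y_def using assms(1,2) by (auto intro: closed_Int_compact)
    show "X \<inter> Y = {}"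
      using w assms(3) unfolding X_def Y_def frontier_def by auto
  qed
  have "frontier W \<subseteq> frontier (- (P \<union> Q \<union> path_image g))"
    using W by (rule frontier_of_components_subset)
  also have "\<dots> \<subseteq> P \<union> Q \<union> path_image g"
    using assms(1,2,4) by (metis compact_Un compact_arc_image compact_imp_closed frontier_complement frontier_subset_closed)
  finally have fr: "frontier W \<subseteq> X \<union> (path_image g \<union> Y)"
    unfolding X_def Y_def by blast
  have bX: "connected_component (- X) s t" "connected_component (- Y) s t"
    unfolding connected_component_def using s t e connected_ball
    by (intro exI[of _ "ball (g m) e"]; auto simp: X_def Y_def)+
  have bg: "connected_component (- path_image g) s t"
    using connected_arc_complement[OF assms(4)] sn t(2) by (simp add: connected_iff_connected_component)
  have "connected_component (- (path_image g \<union> Y)) s t"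
  proof (rule Janiszewski)
    have "path_image g \<inter> Y \<subseteq> {pathfinish g}" using gQ by (auto simp: Y_def)
    then show "connected (path_image g \<inter> Y)" by (metis connected_empty connected_sing subset_singletonD)
  qed (use bX bg XY assms(4) in \<open>auto simp: compact_arc_image compact_imp_closed\<close>)
  then have "connected_component (- (X \<union> (path_image g \<union> Y))) s t"
  proof (rule Janiszewski[rotated -1])
    have "X \<inter> (path_image g \<union> Y) \<subseteq> {pathstart g}" using gP XY(3) by (auto simp: X_def)
    then show "connected (X \<inter> (path_image g \<union> Y))" by (metis connected_empty connected_sing subset_singletonD)
  qed (use bX XY assms(4) in \<open>auto simp: compact_arc_image compact_imp_closed closed_Un\<close>)
  then obtain T where T: "connected T" "T \<subseteq> - (X \<union> (path_image g \<union> Y))" "s \<in> T" "t \<in> T"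
    unfolding connected_component_def by blast
  have "T \<inter> frontier W \<noteq> {}"
    using connected_Int_frontier[OF T(1), of W] T s(1) t(1) by auto
  then show False using T(2) fr by blast
qed

section \<open>Jordan curves through a cut point and the faces on their two sides\<close>

lemma loop_through_arc:
  fixes P Q :: "complex set"
  assumes "path_connected P" "path_connected Q" "P \<inter> Q = {w}" "arc g"
    and gP: "path_image g \<inter> P = {pathstart g}" and gQ: "path_image g \<inter> Q = {pathfinish g}"
    and "pathstart g \<noteq> w" "pathfinish g \<noteq> w"
  obtains c r where "simple_path c" "pathfinish c = pathstart c" "path_image c = path_image g \<union> r"
    "compact r" "connected r" "r \<subseteq> P \<union> Q" "path_image g \<inter> r = {pathstart g, pathfinish g}"
proof -
  have ends: "pathstart g \<in> P" "w \<in> P" "pathfinish g \<in> Q" "w \<in> Q"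
    using gP gQ assms(3) by auto
  \<comment> \<open>One arc runs inside \<open>P\<close> from \<open>w\<close> to the start of
    \<open>g\<close>, another inside \<open>Q\<close> from the end of \<open>g\<close> to
    \<open>w\<close>. They share only \<open>w\<close>, so together with \<open>g\<close> they form
    a Jordan curve.\<close>
  obtain a where a: "arc a" "path_image a \<subseteq> P" "pathstart a = w" "pathfinish a = pathstart g"
    using assms(1)[unfolded path_connected_arcwise, rule_format, OF ends(2,1)] assms(7) by auto
  obtain b where b: "arc b" "path_image b \<subseteq> Q" "pathstart b = pathfinish g" "pathfinish b = w"
    using assms(2)[unfolded path_connected_arcwise, rule_format, OF ends(3,4)] assms(8) by auto
  have ba: "arc (b +++ a)"
    using a b assms(3) by (intro arc_join) auto
  have im: "path_image (b +++ a) = path_image b \<union> path_image a"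
    using a b by (simp add: path_image_join)
  have int: "path_image g \<inter> path_image (b +++ a) = {pathstart g, pathfinish g}"
  proof -
    have "pathstart g \<in> path_image a" "pathfinish g \<in> path_image b"
      using a(4) b(3) by (metis pathfinish_in_path_image, metis pathstart_in_path_image)
    moreover have "path_image g \<inter> path_image a \<subseteq> {pathstart g}" "path_image g \<inter> path_image b \<subseteq> {pathfinish g}"
      using gP gQ a(2) b(2) by blast+
    moreover have "pathstart g \<in> path_image g" "pathfinish g \<in> path_image g"
      by auto
    ultimately show ?thesis unfolding im by blast
  qed
  show thesis
  proof
    show "simple_path (g +++ (b +++ a))"
      using a b ba int assms(4) by (intro simple_path_join_loop) auto
    show "path_image (g +++ (b +++ a)) = path_image g \<union> path_image (b +++ a)"
      using a b by (intro path_image_join) auto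
    show "path_image (b +++ a) \<subseteq> P \<union> Q" using a b im by auto
    show "compact (path_image (b +++ a))" "connected (path_image (b +++ a))"
      using ba by (auto simp: compact_arc_image connected_arc_image)
  qed (use a b int in auto)
qed

lemma connected_inside_outside:
  fixes c :: "real \<Rightarrow> complex"
  assumes "simple_path c" "pathfinish c = pathstart c"
    and "(s \<in> inside (path_image c)) = (s' \<in> inside (path_image c))"
    and "s \<notin> path_image c" "s' \<notin> path_image c"
  shows "connected_component (- path_image c) s s'"
proof -
  note J = Jordan_inside_outside[OF assms(1,2)]
  have "s \<in> inside (path_image c) \<and> s' \<in> inside (path_image c) \<or>
      s \<in> outside (path_image c) \<and> s' \<in> outside (path_image c)"
    using J assms by blast
  then show ?thesis
    unfolding connected_component_def using J by (metis ComplI UnI1 UnI2 subsetI)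
qed

text \<open>Every component into which \<open>g\<close> cuts \<open>W\<close> has the whole arc in
  its closure. There are only finitely many of them, so their closures cover the closure of
  \<open>W - path_image g\<close>, and \<open>w\<close>, which is off the arc, lies in one of these
  closures.\<close>

lemma components_split_by_arc:
  fixes X :: "complex set"
  assumes X: "compact X" and g: "arc g" "path_image g \<inter> X \<subseteq> {pathstart g, pathfinish g}"
    and c: "simple_path c" "pathfinish c = pathstart c" "path_image c = path_image g \<union> r"
    and r: "compact r" "connected r" "r \<subseteq> X" "path_image g \<inter> r = {pathstart g, pathfinish g}"
    and W: "W \<in> components (- X)" "W \<inter> path_image g \<noteq> {}"
    and w: "w \<in> closure W" "w \<notin> path_image g"
  obtains F where "F \<in> components (- (X \<union> path_image g))" "F \<subseteq> W" "w \<in> closure F" "path_image g \<subseteq> closure F"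
proof -
  define Fs where "Fs = {F \<in> components (- (X \<union> path_image g)). F \<subseteq> W}"
  have m: "0 < (1/2::real)" "(1/2::real) < 1" by auto
  have Wn: "W \<subseteq> - X" "connected W" using W in_components_subset in_components_connected by auto
  obtain m0 where m0: "g m0 \<in> W" "0 < m0" "m0 < 1"
  proof -
    obtain m0 where m0: "g m0 \<in> W" "0 \<le> m0" "m0 \<le> 1" using W by (auto simp: path_image_def)
    have "g 0 \<in> X" "g 1 \<in> X" using r(3,4) by (auto simp: pathstart_def pathfinish_def)
    then have "m0 \<noteq> 0" "m0 \<noteq> 1" using m0 Wn by auto
    then show thesis using m0 that by auto
  qed
  have clF: "path_image g \<subseteq> closure F" if F: "F \<in> Fs" for F
  proof -
    obtain z where z: "z \<in> F" using F in_components_nonempty unfolding Fs_def by blast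
    show ?thesis
    proof (rule arc_subset_closure_component[OF X g])
      show "connected_component (- X) z (g m0)"
        unfolding connected_component_def using Wn z F m0 by (auto simp: Fs_def)
    qed (use F z m0 in \<open>auto simp: Fs_def\<close>)
  qed
  \<comment> \<open>Each component has a point close to the midpoint of \<open>g\<close>, inside or
    outside the loop \<open>c\<close>. Two such points on the same side are not separated, so there
    are at most two components.\<close>
  have "finite Fs"
  proof -
    obtain e where "e > 0" and e: "\<And>s s'. s \<in> ball (g (1/2)) e \<Longrightarrow> s' \<in> ball (g (1/2)) e \<Longrightarrow>
        connected_component (- path_image c) s s' \<Longrightarrow> connected_component (- (X \<union> path_image g)) s s'"
      using same_side_not_separated[OF X g r(1,2) c(3) r(4) m] by blast
    have "\<exists>s. s \<in> F \<and> s \<in> ball (g (1/2)) e" if "F \<in> Fs" for F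
    proof -
      have "g (1/2) \<in> closure F" using clF[OF that] by (auto simp: path_image_def)
      then show ?thesis using \<open>e > 0\<close> by (metis closure_approachable dist_commute mem_ball)
    qed
    then obtain pt where pt: "\<And>F. F \<in> Fs \<Longrightarrow> pt F \<in> F \<and> pt F \<in> ball (g (1/2)) e"
      by metis
    have "inj_on (\<lambda>F. pt F \<in> inside (path_image c)) Fs"
    proof (rule inj_onI)
      fix F F' assume F: "F \<in> Fs" "F' \<in> Fs"
        and eq: "(pt F \<in> inside (path_image c)) = (pt F' \<in> inside (path_image c))"
      have sub: "F \<subseteq> - path_image c" "F' \<subseteq> - path_image c"
        using F c(3) r(3) in_components_subset unfolding Fs_def by blast+
      have "connected_component (- path_image c) (pt F) (pt F')"
        using connected_inside_outside[OF c(1,2) eq] pt F sub by blast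
      then have "connected_component (- (X \<union> path_image g)) (pt F) (pt F')"
        using e pt F by blast
      then obtain T where T: "connected T" "T \<subseteq> - (X \<union> path_image g)" "pt F \<in> T" "pt F' \<in> T"
        unfolding connected_component_def by blast
      have "T \<subseteq> F" "T \<subseteq> F'"
        using components_maximal[of _ "- (X \<union> path_image g)" T] T pt F unfolding Fs_def by blast+
      then show "F = F'"
        using components_eq[of F "- (X \<union> path_image g)" F'] T F unfolding Fs_def by blast
    qed
    then show ?thesis by (rule finite_imageD[rotated]) auto
  qed
  have cover: "W - path_image g \<subseteq> \<Union>Fs"
  proof
    fix z assume z: "z \<in> W - path_image g"
    then have zn: "z \<in> - (X \<union> path_image g)" using Wn by auto
    let ?F = "connected_component_set (- (X \<union> path_image g)) z"
    have "?F \<subseteq> W"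
      by (rule components_maximal[OF W(1)])
         (use z zn connected_component_subset[of "- (X \<union> path_image g)" z] in auto)
    then show "z \<in> \<Union>Fs" using zn unfolding Fs_def by (auto intro!: componentsI bexI[of _ ?F])
  qed
  have "w \<in> closure (W - path_image g)"
  proof -
    have "w \<in> - path_image g \<inter> closure W" using w by auto
    also have "\<dots> \<subseteq> closure (- path_image g \<inter> W)"
      using g(1) by (intro open_Int_closure_subset open_Compl compact_imp_closed compact_arc_image)
    finally show ?thesis by (simp add: Diff_eq Int_commute)
  qed
  moreover have "closure (W - path_image g) \<subseteq> (\<Union>F\<in>Fs. closure F)"
    using cover closure_subset \<open>finite Fs\<close> by (intro closure_minimal closed_UN) blast+
  ultimately obtain F where "F \<in> Fs" "w \<in> closure F"
    by blast
  then show thesis using that clF by (auto simp: Fs_def)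
qed

text \<open>Induction on the arcs added after \<open>g0\<close>. The invariant is a face within the
  side \<open>I\<close> that has \<open>w\<close> and some whole arc of \<open>T\<close> in its
  closure. A new arc either misses this face or cuts it, and then one of the parts inherits
  \<open>w\<close> and has the new arc in its closure.\<close>

lemma face_in_side_of_loop:
  fixes P Q :: "complex set" and T :: "(real \<Rightarrow> complex) set"
  assumes PQ: "compact P" "compact Q" "path_connected P" "path_connected Q" "P \<inter> Q = {w}"
    and T: "\<And>g. g \<in> T \<Longrightarrow> arc g" "\<And>g. g \<in> T \<Longrightarrow> pathstart g \<noteq> w" "\<And>g. g \<in> T \<Longrightarrow> pathfinish g \<noteq> w"
      "\<And>g. g \<in> T \<Longrightarrow> path_image g \<inter> P = {pathstart g}" "\<And>g. g \<in> T \<Longrightarrow> path_image g \<inter> Q = {pathfinish g}"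
      "\<And>g h. g \<in> T \<Longrightarrow> h \<in> T \<Longrightarrow> g \<noteq> h \<Longrightarrow> path_image g \<inter> path_image h \<subseteq> P \<union> Q"
    and g0: "g0 \<in> T" and J: "J = path_image g0 \<union> r" "r \<subseteq> P \<union> Q"
    and I: "open I" "I' \<noteq> {}" "I \<inter> I' = {}" "I \<union> I' = - J" "frontier I = J" "frontier I' = J"
    and S: "finite S" "S \<subseteq> T - {g0}"
  shows "\<exists>F \<in> components (- (P \<union> Q \<union> path_image g0 \<union> (\<Union>g\<in>S. path_image g))).
    F \<subseteq> I \<and> w \<in> closure F \<and> (\<exists>g \<in> T. path_image g \<subseteq> closure F)"
  using S
proof (induction S rule: finite_induct)
  case empty
  define m :: real where "m = 1/2"
  have m: "0 < m" "m < 1" by (auto simp: m_def)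
  have ar: "arc g0" using T g0 by auto
  have gJ: "g0 m \<in> J" using J m by (auto simp: path_image_def)
  have gm: "g0 m \<notin> P \<union> Q"
    using arc_interior_notin[OF ar _ m, of "P \<union> Q"] T(4,5)[OF g0] by (simp add: Int_Un_distrib)
  have "closed (P \<union> Q)" using PQ(1,2) compact_imp_closed by blast
  then obtain e where "e > 0" and e: "ball (g0 m) e \<subseteq> - (P \<union> Q)"
    by (metis gm ComplI open_Compl open_contains_ball)
  have "g0 m \<in> closure I" using gJ I(5) by (auto simp: frontier_def)
  then obtain s where s: "s \<in> I" "s \<in> ball (g0 m) e"
    using \<open>e > 0\<close> by (metis closure_approachable dist_commute mem_ball)
  define W where "W = connected_component_set (- (P \<union> Q \<union> path_image g0)) s"
  have sn: "s \<in> - (P \<union> Q \<union> path_image g0)" using s e I(4) J by blast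
  have W: "W \<in> components (- (P \<union> Q \<union> path_image g0))" "s \<in> W"
    using sn unfolding W_def by (auto intro: componentsI)
  \<comment> \<open>\<open>W\<close> is connected and avoids \<open>J\<close>, the frontier of
    \<open>I\<close>, so it cannot leave \<open>I\<close>.\<close>
  have "W \<subseteq> I"
  proof (rule ccontr)
    assume "\<not> W \<subseteq> I"
    then have "W \<inter> frontier I \<noteq> {}"
      using connected_Int_frontier[of W I] W s(1) in_components_connected by blast
    then show False using I(5) J W(1) in_components_subset by blast
  qed
  have cl: "path_image g0 \<subseteq> closure W"
  proof (rule arc_subset_closure_component[OF _ ar _ W _ m])
    show "compact (P \<union> Q)" using PQ by auto
    show "path_image g0 \<inter> (P \<union> Q) \<subseteq> {pathstart g0, pathfinish g0}" using T(4,5)[OF g0] by auto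
    show "connected_component (- (P \<union> Q)) s (g0 m)"
      unfolding connected_component_def using e s \<open>e > 0\<close> by (intro exI[of _ "ball (g0 m) e"]) auto
  qed
  \<comment> \<open>The other side \<open>I'\<close> also comes arbitrarily close to
    \<open>g0 m\<close> and is disjoint from \<open>W\<close>; these are the points outside
    \<open>W\<close> by which \<open>W\<close> is forced to reach \<open>w\<close>.\<close>
  have "g0 m \<in> closure I'" using gJ I(6) by (auto simp: frontier_def)
  moreover have "I' \<subseteq> - (W \<union> path_image g0)" using \<open>W \<subseteq> I\<close> I(3,4) J by blast
  ultimately have "g0 m \<in> closure (- (W \<union> path_image g0))" using closure_mono by blast
  moreover have "g0 m \<in> closure W" using cl m by (auto simp: path_image_def)
  ultimately have "w \<in> closure W"
    using base_face_touches[OF PQ(1,2,5) ar T(4,5)[OF g0] W(1) m] by blast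
  then show ?case using W(1) \<open>W \<subseteq> I\<close> cl g0 by auto
next
  case (insert t S)
  let ?X = "P \<union> Q \<union> path_image g0 \<union> (\<Union>g\<in>S. path_image g)"
  obtain W g where W: "W \<in> components (- ?X)" "W \<subseteq> I" "w \<in> closure W" "g \<in> T" "path_image g \<subseteq> closure W"
    using insert by auto
  have t: "t \<in> T" "arc t" using insert T by auto
  have eq: "P \<union> Q \<union> path_image g0 \<union> (\<Union>g\<in>insert t S. path_image g) = ?X \<union> path_image t"
    by auto
  show ?case unfolding eq
  proof (cases "W \<inter> path_image t = {}")
    case True
    have "W \<in> components (- (?X \<union> path_image t))"
      using W(1) True unfolding in_components_maximal by (auto simp del: Un_iff)
    then show "\<exists>F \<in> components (- (?X \<union> path_image t)). F \<subseteq> I \<and> w \<in> closure F \<and> (\<exists>g \<in> T. path_image g \<subseteq> closure F)"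
      using W by blast
  next
    case False
    have tX: "path_image t \<inter> ?X \<subseteq> {pathstart t, pathfinish t}"
    proof -
      have *: "path_image t \<inter> (P \<union> Q) \<subseteq> {pathstart t, pathfinish t}" using T(4,5)[OF t(1)] by auto
      have "path_image t \<inter> path_image h \<subseteq> P \<union> Q" if "h \<in> insert g0 S" for h
        using T(6)[OF t(1), of h] that insert g0 by auto
      then show ?thesis using * by blast
    qed
    obtain c r where c: "simple_path c" "pathfinish c = pathstart c" "path_image c = path_image t \<union> r"
      and r: "compact r" "connected r" "r \<subseteq> P \<union> Q" "path_image t \<inter> r = {pathstart t, pathfinish t}"
      using loop_through_arc[OF PQ(3,4,5) t(2) T(4,5)[OF t(1)] T(2,3)[OF t(1)]] by blast
    have "compact ?X"
      using PQ(1,2) insert.hyps insert.prems T(1) g0 by (auto intro!: compact_Un compact_UN simp: compact_arc_image)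
    moreover have "w \<notin> path_image t"
      using T(2,4)[OF t(1)] PQ(5) by (metis IntD1 IntI insertI1 singletonD)
    moreover have "r \<subseteq> ?X" using r(3) by auto
    ultimately obtain F where "F \<in> components (- (?X \<union> path_image t))" "F \<subseteq> W" "w \<in> closure F" "path_image t \<subseteq> closure F"
      using components_split_by_arc[OF _ t(2) tX c r(1,2) _ r(4) W(1) False W(3)] by blast
    then show "\<exists>F \<in> components (- (?X \<union> path_image t)). F \<subseteq> I \<and> w \<in> closure F \<and> (\<exists>g \<in> T. path_image g \<subseteq> closure F)"
      using W(2) t(1) by blast
  qed
qed

text \<open>One arc of \<open>T\<close> closes up to a Jordan curve through \<open>w\<close>. Its
  inside and its outside each contribute a face, and the two differ because they lie on different
  sides.\<close>

theorem two_faces_at_cut_point: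
  fixes P Q :: "complex set" and T :: "(real \<Rightarrow> complex) set"
  assumes PQ: "compact P" "compact Q" "path_connected P" "path_connected Q" "P \<inter> Q = {w}"
    and fT: "finite T" and T0: "T \<noteq> {}"
    and T: "\<And>g. g \<in> T \<Longrightarrow> arc g" "\<And>g. g \<in> T \<Longrightarrow> pathstart g \<noteq> w" "\<And>g. g \<in> T \<Longrightarrow> pathfinish g \<noteq> w"
      "\<And>g. g \<in> T \<Longrightarrow> path_image g \<inter> P = {pathstart g}" "\<And>g. g \<in> T \<Longrightarrow> path_image g \<inter> Q = {pathfinish g}"
      "\<And>g h. g \<in> T \<Longrightarrow> h \<in> T \<Longrightarrow> g \<noteq> h \<Longrightarrow> path_image g \<inter> path_image h \<subseteq> P \<union> Q"
  obtains F1 F2 where "F1 \<noteq> F2"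
    "\<And>F. F \<in> {F1, F2} \<Longrightarrow> F \<in> components (- (P \<union> Q \<union> (\<Union>g\<in>T. path_image g))) \<and> w \<in> frontier F
       \<and> (\<exists>g\<in>T. path_image g \<subseteq> frontier F)"
proof -
  obtain g0 where g0: "g0 \<in> T" using T0 by blast
  obtain c r where c: "simple_path c" "pathfinish c = pathstart c" "path_image c = path_image g0 \<union> r"
      and r0: "compact r" "connected r" and r: "r \<subseteq> P \<union> Q" and "path_image g0 \<inter> r = {pathstart g0, pathfinish g0}"
    by (rule loop_through_arc[OF PQ(3,4,5) T(1)[OF g0] T(4)[OF g0] T(5)[OF g0] T(2)[OF g0] T(3)[OF g0]])
  note Jd = Jordan_inside_outside[OF c(1,2)]
  have fin: "finite (T - {g0})" using fT by auto
  have eq: "P \<union> Q \<union> path_image g0 \<union> (\<Union>g\<in>T-{g0}. path_image g) = P \<union> Q \<union> (\<Union>g\<in>T. path_image g)"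
    using g0 by auto
  have side: "\<exists>F \<in> components (- (P \<union> Q \<union> (\<Union>g\<in>T. path_image g))).
      F \<subseteq> I \<and> w \<in> closure F \<and> (\<exists>g \<in> T. path_image g \<subseteq> closure F)"
    if "open I" "I' \<noteq> {}" "I \<inter> I' = {}" "I \<union> I' = - path_image c" "frontier I = path_image c" "frontier I' = path_image c"
    for I I'
    using face_in_side_of_loop[OF PQ T g0 c(3) r that fin] unfolding eq by auto
  obtain F1 g1 where F1: "F1 \<in> components (- (P \<union> Q \<union> (\<Union>g\<in>T. path_image g)))" "F1 \<subseteq> inside (path_image c)"
      "w \<in> closure F1" "g1 \<in> T" "path_image g1 \<subseteq> closure F1"
    using side[of "inside (path_image c)" "outside (path_image c)"] Jd by auto
  obtain F2 g2 where F2: "F2 \<in> components (- (P \<union> Q \<union> (\<Union>g\<in>T. path_image g)))" "F2 \<subseteq> outside (path_image c)"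
      "w \<in> closure F2" "g2 \<in> T" "path_image g2 \<subseteq> closure F2"
    using side[of "outside (path_image c)" "inside (path_image c)"] Jd by (auto simp: Int_commute Un_commute)
  have "F1 \<noteq> F2"
  proof
    assume "F1 = F2"
    then have "F1 \<subseteq> {}" using F1(2) F2(2) Jd by (metis Int_greatest)
    then show False using in_components_nonempty[OF F1(1)] by simp
  qed
  have cl: "compact (P \<union> Q \<union> (\<Union>g\<in>T. path_image g))"
    using PQ(1,2) fT T(1) by (auto intro!: compact_Un compact_UN simp: compact_arc_image)
  \<comment> \<open>Faces are open, so points of the drawing in the closure of a face are frontier
    points.\<close>
  have fr: "frontier F = closure F - F" if "F \<in> components (- (P \<union> Q \<union> (\<Union>g\<in>T. path_image g)))" for F
    using that cl by (metis compact_imp_closed frontier_def interior_open open_Compl open_components)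
  have "w \<in> P" using PQ(5) by auto
  show thesis
  proof (rule that[OF \<open>F1 \<noteq> F2\<close>])
    fix F assume "F \<in> {F1, F2}"
    then obtain g where F: "F \<in> components (- (P \<union> Q \<union> (\<Union>g\<in>T. path_image g)))"
      "w \<in> closure F" "g \<in> T" "path_image g \<subseteq> closure F"
      using F1 F2 by blast
    then have "w \<notin> F" "path_image g \<inter> F = {}"
      using in_components_subset \<open>w \<in> P\<close> by fastforce+
    then show "F \<in> components (- (P \<union> Q \<union> (\<Union>g\<in>T. path_image g))) \<and> w \<in> frontier F
       \<and> (\<exists>g\<in>T. path_image g \<subseteq> frontier F)"
      using F fr[OF F(1)] by blast
  qed
qed

section \<open>Collapsing an arc\<close>

text \<open>Inversion at an end of the arc turns the complement of the arc in the sphere into a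
  simply connected plane domain \<open>W\<close>, with infinity sent to 0. By the Riemann mapping
  theorem \<open>W\<close> is homeomorphic to the plane, and a second inversion, at the image of 0,
  restores infinity and shrinks the arc to a point.\<close>

lemma arc_collapse:
  fixes g :: "real \<Rightarrow> complex"
  assumes "arc g"
  obtains \<kappa> :: "complex \<Rightarrow> complex" where "continuous_on UNIV \<kappa>"
    "\<And>z. \<kappa> z = 0 \<longleftrightarrow> z \<in> path_image g" "inj_on \<kappa> (- path_image g)"
proof -
  define A where "A = path_image g"
  define a where "a = pathstart g"
  define f where "f = (\<lambda>z. inverse (z - a))"
  define W where "W = {y. y = 0 \<or> a + inverse y \<notin> A}"
  have A: "compact A" "a \<in> A" "connected (- A)"
    using assms by (auto simp: A_def a_def compact_arc_image connected_arc_complement)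
  have fW: "f z \<in> W" "f z \<noteq> 0" if "z \<notin> A" for z
    using that A(2) by (auto simp: f_def W_def)
  \<comment> \<open>As \<open>inverse 0 = 0\<close>, this identity and the next hold without
    exception, also at \<open>z = a\<close> and \<open>y = 0\<close>.\<close>
  have finv: "a + inverse (f z) = z" for z
    by (simp add: f_def)
  have invf: "f (a + inverse y) = y" for y
    by (simp add: f_def)
  have Wf: "W - {0} = f ` (- A)"
  proof
    show "W - {0} \<subseteq> f ` (- A)"
    proof
      fix y assume "y \<in> W - {0}"
      then have "y = f (a + inverse y)" "a + inverse y \<in> - A"
        using invf by (auto simp: W_def)
      then show "y \<in> f ` (- A)" by blast
    qed
    show "f ` (- A) \<subseteq> W - {0}" using fW by auto
  qed
  have cW: "- W = f ` (A - {a})"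
  proof
    show "- W \<subseteq> f ` (A - {a})"
    proof
      fix y assume "y \<in> - W"
      then have "y = f (a + inverse y)" "a + inverse y \<in> A - {a}"
        using invf by (auto simp: W_def)
      then show "y \<in> f ` (A - {a})" by blast
    qed
    show "f ` (A - {a}) \<subseteq> - W" using finv by (auto simp: W_def f_def)
  qed
  obtain B where B: "B > 0" "A \<subseteq> ball a B"
    using A(1) compact_imp_bounded bounded_subset_ballD by blast
  have ballW: "ball 0 (1/B) \<subseteq> W"
  proof
    fix y :: complex assume y: "y \<in> ball 0 (1/B)"
    show "y \<in> W"
    proof (cases "y = 0")
      case False
      have "B < cmod (inverse y)"
        using y False B(1) by (simp add: norm_inverse norm_divide field_simps)
      then have "a + inverse y \<notin> ball a B" by (simp add: dist_norm)
      then show ?thesis using B by (auto simp: W_def)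
    qed (simp add: W_def)
  qed
  have oW: "open W"
  proof -
    have "open (- {0} \<inter> (\<lambda>y. a + inverse y) -` (- A))"
      using A(1) by (intro continuous_open_preimage continuous_intros) (auto simp: open_Compl compact_imp_closed)
    moreover have "W = (- {0} \<inter> (\<lambda>y. a + inverse y) -` (- A)) \<union> ball 0 (1/B)"
      using ballW B(1) by (auto simp: W_def)
    ultimately show ?thesis by auto
  qed
  have contf: "continuous_on (- {a}) f"
    unfolding f_def by (intro continuous_intros) auto
  \<comment> \<open>\<open>W\<close> arises from the connected image of the complement of the arc by
    adding its limit point 0, which stands for infinity.\<close>
  have connW: "connected W"
  proof (rule connected_intermediate_closure)
    show "connected (f ` (- A))"
      using A contf by (intro connected_continuous_image) (auto elim: continuous_on_subset)
    show "f ` (- A) \<subseteq> W" using fW by auto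
    have "0 \<in> closure (W - {0})"
    proof (clarsimp simp: closure_approachable)
      fix e :: real assume "e > 0"
      obtain x where x: "0 < x" "x < min e (1/B)"
        using \<open>e > 0\<close> B(1) by (metis dense min_less_iff_conj zero_less_divide_1_iff)
      define y where "y = complex_of_real x"
      have "y \<noteq> 0" "cmod y < e" "cmod y < 1/B"
        using x by (auto simp: y_def)
      then show "\<exists>y\<in>W - {0}. cmod y < e" using ballW by (intro bexI[of _ y]) auto
    qed
    then show "W \<subseteq> closure (f ` (- A))"
      using Wf closure_subset[of "W - {0}"] by auto
  qed
  have Ag: "A - {a} = g ` {0<..1}"
  proof -
    have "{0..1} = insert 0 {0<..(1::real)}" by auto
    moreover have "g 0 \<notin> g ` {0<..1}" by (rule arc_image_notin[OF assms]) auto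
    ultimately show ?thesis by (auto simp: A_def a_def path_image_def pathstart_def)
  qed
  have conC: "connected (- W)"
  proof -
    have "connected (g ` {0<..1})"
      using assms by (intro connected_continuous_image) (auto simp: arc_def path_def elim: continuous_on_subset)
    moreover have "continuous_on (A - {a}) f" using contf by (rule continuous_on_subset) auto
    ultimately show ?thesis unfolding cW
      using Ag by (intro connected_continuous_image) auto
  qed
  \<comment> \<open>Points of the arc near its end \<open>a\<close> are sent arbitrarily far. Being
    connected and unbounded, the complement of \<open>W\<close> makes \<open>W\<close> simply
    connected.\<close>
  have unb: "\<not> bounded (- W)"
  proof
    assume "bounded (- W)"
    then obtain M where M: "M > 0" "\<And>y. y \<in> - W \<Longrightarrow> cmod y \<le> M"
      unfolding bounded_pos by blast
    have "continuous_on {0..1} g" using assms by (simp add: arc_def path_def)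
    then obtain d where "d > 0" and d: "\<And>x. x \<in> {0..1} \<Longrightarrow> dist x 0 < d \<Longrightarrow> dist (g x) (g 0) < 1/M"
      using M(1) by (metis atLeastAtMost_iff continuous_on_iff order_refl zero_le_one zero_less_divide_1_iff)
    define x where "x = min 1 (d/2)"
    have x: "0 < x" "x \<le> 1" "x < d" using \<open>d > 0\<close> by (auto simp: x_def)
    then have "g x \<in> A - {a}" unfolding Ag by auto
    then have "f (g x) \<in> - W" "g x \<noteq> a" unfolding cW by auto
    then have "cmod (inverse (g x - a)) \<le> M" using M(2) by (simp add: f_def)
    moreover have "cmod (g x - a) < 1/M" using d[of x] x by (auto simp: a_def pathstart_def dist_norm)
    ultimately show False using M(1) \<open>g x \<noteq> a\<close> by (simp add: norm_inverse norm_divide field_simps)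
  qed
  have "- W \<noteq> {}" using unb by auto
  have "components (- W) = {- W}"
    using conC \<open>- W \<noteq> {}\<close> by (simp add: components_eq_sing_iff)
  then have "simply_connected W"
    using simply_connected_eq_unbounded_complement_components[OF oW] connW unb by simp
  then have "W homeomorphic ball (0::complex) 1"
    using simply_connected_eq_homeomorphic_to_disc[OF oW] by (auto simp: W_def)
  then have "W homeomorphic (UNIV :: complex set)"
    using homeomorphic_ball01_UNIV homeomorphic_trans by blast
  then obtain h k where hk: "homeomorphism W (UNIV :: complex set) h k" unfolding homeomorphic_def by blast
  have h: "continuous_on W h" "continuous_on UNIV k" "\<And>y. k y \<in> W" "\<And>y. h (k y) = y" "\<And>x. x \<in> W \<Longrightarrow> k (h x) = x"
    using hk by (auto simp: homeomorphism_def)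
  have injh: "inj_on h W" using h(5) by (metis inj_on_inverseI)
  have "0 \<in> W" by (simp add: W_def)
  define \<kappa> where "\<kappa> = (\<lambda>z. if z \<in> A then 0 else inverse (h (f z) - h 0))"
  have nz: "h (f z) \<noteq> h 0" if "z \<notin> A" for z
    using fW[OF that] injh \<open>0 \<in> W\<close> by (metis inj_onD)
  have inj: "inj_on \<kappa> (- A)"
  proof (rule inj_onI)
    fix x y assume "x \<in> - A" "y \<in> - A" "\<kappa> x = \<kappa> y"
    then have "h (f x) = h (f y)" by (auto simp: \<kappa>_def)
    then have "f x = f y" using injh fW \<open>x \<in> - A\<close> \<open>y \<in> - A\<close> by (metis ComplD inj_onD)
    then show "x = y" using finv by metis
  qed
  have "isCont \<kappa> z" for z
  proof (cases "z \<in> A")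
    case False
    have "continuous_on (- A) (\<lambda>z. inverse (h (f z) - h 0))"
      using nz fW A(2) contf
      by (intro continuous_intros continuous_on_compose2[OF h(1)]) (auto elim: continuous_on_subset)
    then have "continuous_on (- A) \<kappa>"
      by (rule continuous_on_eq) (auto simp: \<kappa>_def)
    then show ?thesis using False A(1)
      by (auto simp: continuous_on_eq_continuous_at compact_imp_closed open_Compl)
  next
    case True
    have "\<exists>d>0. \<forall>x. dist x z < d \<longrightarrow> dist (\<kappa> x) (\<kappa> z) < e" if "e > 0" for e
    proof -
      \<comment> \<open>Off this compact part of \<open>W\<close>, values of \<open>h\<close> are
        farther than \<open>1/e\<close> from \<open>h 0\<close>, which makes \<open>\<kappa>\<close>
        smaller than \<open>e\<close>. Near a point \<open>z\<close> of the arc, \<open>f\<close>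
        does avoid \<open>K\<close>: at \<open>z = a\<close> because \<open>f\<close> tends to
        infinity there, elsewhere because \<open>f\<close> is continuous at \<open>z\<close> and
        \<open>f z\<close> lies outside \<open>W\<close>.\<close>
      define K where "K = k ` cball (h 0) (1/e)"
      have K: "compact K" "K \<subseteq> W"
        using h(2,3) by (auto simp: K_def intro!: compact_continuous_image elim: continuous_on_subset)
      have small: "dist (\<kappa> x) (\<kappa> z) < e" if "x \<in> A \<or> f x \<notin> K" for x
      proof (cases "x \<in> A")
        case False
        then have "f x \<notin> K" using that by auto
        then have "1/e < dist (h 0) (h (f x))"
          unfolding K_def using h(5)[OF fW(1)[OF False]] by (metis image_eqI mem_cball not_le)
        then have "inverse (dist (h 0) (h (f x))) < inverse (1/e)"
          using \<open>e > 0\<close> by (intro less_imp_inverse_less) auto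
        moreover have "dist (\<kappa> x) (\<kappa> z) = inverse (dist (h 0) (h (f x)))"
          using True False by (simp add: \<kappa>_def dist_norm norm_inverse norm_minus_commute[of "h 0"])
        ultimately show ?thesis by simp
      qed (use True \<open>e > 0\<close> in \<open>simp add: \<kappa>_def\<close>)
      show ?thesis
      proof (cases "z = a")
        case True
        obtain M where M: "M > 0" "\<And>y. y \<in> K \<Longrightarrow> cmod y \<le> M"
          using compact_imp_bounded[OF K(1)] unfolding bounded_pos by blast
        have "dist (\<kappa> x) (\<kappa> z) < e" if "dist x z < 1/M" for x
        proof (rule small, rule ccontr)
          assume "\<not> (x \<in> A \<or> f x \<notin> K)"
          then have "cmod (f x) \<le> M" "x \<noteq> a" using M(2) A(2) by auto
          then show False using that True M(1) by (simp add: f_def norm_inverse norm_divide dist_norm field_simps)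
        qed
        then show ?thesis using M(1) by (intro exI[of _ "1/M"]) auto
      next
        case False
        have "f z \<in> - W" using \<open>z \<in> A\<close> False unfolding cW by auto
        then have "f z \<in> - K" using K(2) by auto
        moreover have "open (- {a} \<inter> f -` (- K))"
          using contf K(1) by (intro continuous_open_preimage) (auto simp: compact_imp_closed)
        ultimately obtain d where "d > 0" "ball z d \<subseteq> - {a} \<inter> f -` (- K)"
          using False by (metis ComplI IntI open_contains_ball singletonD vimageI)
        then show ?thesis using small by (intro exI[of _ d]) (auto simp: dist_commute subset_eq)
      qed
    qed
    then show ?thesis unfolding continuous_at_eps_delta by blast
  qed
  then have "continuous_on UNIV \<kappa>" by (simp add: continuous_at_imp_continuous_on)
  moreover have "\<kappa> z = 0 \<longleftrightarrow> z \<in> path_image g" for z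
    using nz[of z] by (auto simp: \<kappa>_def A_def)
  ultimately show thesis using that inj unfolding A_def by blast
qed

section \<open>Plane graphs\<close>

definition induced :: "'a set set \<Rightarrow> 'a set \<Rightarrow> 'a set set" where
  "induced E X = {e \<in> E. e \<subseteq> X}"

text \<open>Connectivity of the subgraph on \<open>S\<close> is stated through cuts instead of
  paths, which suits the arguments about closed-off subsets. The empty set counts as
  connected.\<close>

definition graph_connected :: "'a set set \<Rightarrow> 'a set \<Rightarrow> bool" where
  "graph_connected E S \<longleftrightarrow> (\<forall>X \<subseteq> S. X \<noteq> {} \<and> X \<noteq> S \<longrightarrow> (\<exists>x \<in> X. \<exists>y \<in> S - X. {x, y} \<in> E))"

lemma graph_connectedD:
  assumes "graph_connected E S" "X \<subseteq> S" "X \<noteq> {}" "\<And>x y. x \<in> X \<Longrightarrow> y \<in> S - X \<Longrightarrow> {x, y} \<notin> E"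
  shows "X = S"
  using assms unfolding graph_connected_def by blast

lemma induced_mono: "induced E X \<subseteq> E"
  by (auto simp: induced_def)

lemma simple_graph_subset:
  assumes "simple_graph V E" "W \<subseteq> V" "D \<subseteq> E" "\<Union>D \<subseteq> W"
  shows "simple_graph W D"
  using assms unfolding simple_graph_def by (auto intro: finite_subset)

lemma simple_graph_edgeE:
  assumes "simple_graph V E" "e \<in> E"
  obtains u w where "e = {u, w}" "u \<noteq> w" "u \<in> V" "w \<in> V"
  using assms unfolding simple_graph_def by (metis card_2_iff insert_subset)

lemma simple_graph_finite_edges: "simple_graph V E \<Longrightarrow> finite E"
  unfolding simple_graph_def by (meson Pow_iff finite_Pow_iff finite_subset subsetI)

section \<open>Subdrawings, arcs inside drawings, added edges and identified vertices\<close>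

lemma plane_embeddingD:
  assumes "plane_embedding V E pos \<gamma>"
  shows "inj_on pos V" and "e \<in> E \<Longrightarrow> arc (\<gamma> e)"
    and "e \<in> E \<Longrightarrow> {pathstart (\<gamma> e), pathfinish (\<gamma> e)} = pos ` e"
    and "e \<in> E \<Longrightarrow> path_image (\<gamma> e) \<inter> pos ` V = pos ` e"
    and "e \<in> E \<Longrightarrow> e' \<in> E \<Longrightarrow> e \<noteq> e' \<Longrightarrow> path_image (\<gamma> e) \<inter> path_image (\<gamma> e') = pos ` (e \<inter> e')"
  using assms unfolding plane_embedding_def by blast+

lemma plane_embedding_subset:
  assumes "plane_embedding V E pos \<gamma>" "W \<subseteq> V" "D \<subseteq> E" "\<Union>D \<subseteq> W"
  shows "plane_embedding W D pos \<gamma>"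
proof -
  have "path_image (\<gamma> e) \<inter> pos ` W = pos ` e" if "e \<in> D" for e
  proof -
    have "path_image (\<gamma> e) \<inter> pos ` V = pos ` e" using plane_embeddingD(4)[OF assms(1)] that assms(3) by blast
    moreover have "e \<subseteq> W" using that assms by auto
    ultimately show ?thesis using assms(2) by blast
  qed
  moreover have "inj_on pos W" using assms inj_on_subset by (auto simp: plane_embedding_def)
  ultimately show ?thesis
    using assms(1,3) unfolding plane_embedding_def by (simp add: subset_iff)
qed

lemma planar_subset:
  assumes "planar V E" "W \<subseteq> V" "D \<subseteq> E" "\<Union>D \<subseteq> W"
  shows "planar W D"
  using assms plane_embedding_subset unfolding planar_def by metis

text \<open>Arcs meet only in common ends and pass through no other vertices. Disjointness of drawn
  parts can thus be read off from vertex and edge sets.\<close>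

lemma drawing_Int:
  assumes emb: "plane_embedding V E pos \<gamma>" and "X \<subseteq> V" "Y \<subseteq> V" "A \<subseteq> E" "B \<subseteq> E" "\<Union>A \<subseteq> X" "\<Union>B \<subseteq> Y"
  shows "drawing X A pos \<gamma> \<inter> drawing Y B pos \<gamma> = drawing (X \<inter> Y) (A \<inter> B) pos \<gamma>"
proof -
  have inj: "inj_on pos V" using emb by (simp add: plane_embedding_def)
  have vv: "pos ` X \<inter> pos ` Y = pos ` (X \<inter> Y)"
    using inj_on_image_Int[OF inj] assms by auto
  have ve: "pos ` X' \<inter> path_image (\<gamma> e) \<subseteq> pos ` (X' \<inter> e)" if "e \<in> E" "e \<subseteq> V" "X' \<subseteq> V" for X' e
  proof -
    have "path_image (\<gamma> e) \<inter> pos ` V = pos ` e" using plane_embeddingD(4)[OF emb] that by blast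
    then have "pos ` X' \<inter> path_image (\<gamma> e) \<subseteq> pos ` X' \<inter> pos ` e" using that by blast
    then show ?thesis using inj_on_image_Int[OF inj that(3,2)] by simp
  qed
  have ee: "path_image (\<gamma> e) \<inter> path_image (\<gamma> e') = pos ` (e \<inter> e')" if "e \<in> E" "e' \<in> E" "e \<noteq> e'" for e e'
    using emb that by (simp add: plane_embedding_def)
  show ?thesis
  proof (rule antisym)
    show "drawing (X \<inter> Y) (A \<inter> B) pos \<gamma> \<subseteq> drawing X A pos \<gamma> \<inter> drawing Y B pos \<gamma>"
      by (auto simp: drawing_def)
    show "drawing X A pos \<gamma> \<inter> drawing Y B pos \<gamma> \<subseteq> drawing (X \<inter> Y) (A \<inter> B) pos \<gamma>"
    proof
      fix z assume z: "z \<in> drawing X A pos \<gamma> \<inter> drawing Y B pos \<gamma>"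
      consider "z \<in> pos ` X" "z \<in> pos ` Y"
        | e where "z \<in> pos ` X" "e \<in> B" "z \<in> path_image (\<gamma> e)"
        | e where "z \<in> pos ` Y" "e \<in> A" "z \<in> path_image (\<gamma> e)"
        | e e' where "e \<in> A" "z \<in> path_image (\<gamma> e)" "e' \<in> B" "z \<in> path_image (\<gamma> e')"
        using z unfolding drawing_def by blast
      then show "z \<in> drawing (X \<inter> Y) (A \<inter> B) pos \<gamma>"
      proof cases
        case 1 then show ?thesis using vv by (auto simp: drawing_def)
      next
        case (2 e)
        then have "z \<in> pos ` (X \<inter> e)" "e \<subseteq> Y" using ve[of e X] assms by blast+
        then show ?thesis by (auto simp: drawing_def)
      next
        case (3 e)
        then have "z \<in> pos ` (Y \<inter> e)" "e \<subseteq> X" using ve[of e Y] assms by blast+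
        then show ?thesis by (auto simp: drawing_def)
      next
        case (4 e e')
        show ?thesis
        proof (cases "e = e'")
          case True then show ?thesis using 4 by (auto simp: drawing_def)
        next
          case False
          then have "z \<in> pos ` (e \<inter> e')" using ee[of e e'] 4 assms by blast
          moreover have "e \<subseteq> X" "e' \<subseteq> Y" using 4 assms by blast+
          ultimately show ?thesis by (auto simp: drawing_def)
        qed
      qed
    qed
  qed
qed

lemma compact_drawing:
  assumes "plane_embedding V E pos \<gamma>" "finite X" "finite A" "A \<subseteq> E"
  shows "compact (drawing X A pos \<gamma>)"
  unfolding drawing_def using assms
  by (auto simp: plane_embedding_def compact_arc_image finite_imp_compact intro!: compact_Un compact_UN)

lemma edge_path_image:
  assumes "plane_embedding V E pos \<gamma>" "{x, y} \<in> E"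
  shows "pos x \<in> path_image (\<gamma> {x, y})" "pos y \<in> path_image (\<gamma> {x, y})"
proof -
  have "path_image (\<gamma> {x,y}) \<inter> pos ` V = pos ` {x,y}" using assms by (simp add: plane_embedding_def)
  then show "pos x \<in> path_image (\<gamma> {x, y})" "pos y \<in> path_image (\<gamma> {x, y})" by auto
qed

lemma path_connected_drawing:
  assumes emb: "plane_embedding V E pos \<gamma>" and sg: "simple_graph V E" and con: "graph_connected E X"
  shows "path_connected (drawing X (induced E X) pos \<gamma>)" (is "path_connected ?D")
proof (cases "X = {}")
  case True
  then have "?D = {}" using sg by (auto simp: drawing_def induced_def simple_graph_def)
  then show ?thesis by simp
next
  case False
  then obtain x0 where x0: "x0 \<in> X" by blast
  have edge: "path_component ?D z z'" if "e \<in> induced E X" "z \<in> path_image (\<gamma> e)" "z' \<in> path_image (\<gamma> e)" for e z z'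
  proof (rule path_component_of_subset)
    show "path_image (\<gamma> e) \<subseteq> ?D" using that by (auto simp: drawing_def)
    have "path_connected (path_image (\<gamma> e))"
      using plane_embeddingD(2)[OF emb, of e] that(1) by (simp add: induced_def arc_imp_path path_connected_path_image)
    then show "path_component (path_image (\<gamma> e)) z z'" using that by (simp add: path_connected_component)
  qed
  define C where "C = {x \<in> X. path_component ?D (pos x0) (pos x)}"
  have "C = X"
  proof (rule graph_connectedD[OF con])
    have "pos x0 \<in> ?D" using x0 by (auto simp: drawing_def)
    then show "C \<noteq> {}" using x0 by (auto simp: C_def path_component_refl)
    show "C \<subseteq> X" by (auto simp: C_def)
    fix x y assume xy: "x \<in> C" "y \<in> X - C"
    show "{x, y} \<notin> E"
    proof
      assume e: "{x, y} \<in> E"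
      then have "{x, y} \<in> induced E X" using xy by (auto simp: induced_def C_def)
      then have "path_component ?D (pos x) (pos y)" using edge edge_path_image[OF emb e] by blast
      then show False using xy unfolding C_def by (auto intro: path_component_trans)
    qed
  qed
  have "path_component ?D (pos x0) z" if z: "z \<in> ?D" for z
  proof -
    consider x where "x \<in> X" "z = pos x" | e where "e \<in> induced E X" "z \<in> path_image (\<gamma> e)"
      using z unfolding drawing_def by blast
    then show ?thesis
    proof cases
      case 1 then show ?thesis using \<open>C = X\<close> by (auto simp: C_def)
    next
      case (2 e)
      then obtain x y where xy: "e = {x, y}" "x \<in> X"
        using simple_graph_edgeE[OF sg] unfolding induced_def by blast
      then have "pos x \<in> path_image (\<gamma> e)" using edge_path_image[OF emb] 2 unfolding induced_def by blast
      then have "path_component ?D (pos x) z" using edge 2 by blast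
      then show ?thesis using xy \<open>C = X\<close> unfolding C_def by (auto intro: path_component_trans)
    qed
  qed
  then show ?thesis unfolding path_connected_component by (meson path_component_sym path_component_trans)
qed

lemma arc_in_drawing:
  assumes emb: "plane_embedding V E pos \<gamma>" and sg: "simple_graph V E" and con: "graph_connected E X"
    and "X \<subseteq> V" "x \<in> X" "y \<in> X" "x \<noteq> y"
  obtains g where "arc g" "path_image g \<subseteq> drawing X (induced E X) pos \<gamma>" "pathstart g = pos x" "pathfinish g = pos y"
proof -
  have "pos x \<noteq> pos y" using plane_embeddingD(1)[OF emb] assms(4-) by (meson inj_onD subsetD)
  moreover have "pos x \<in> drawing X (induced E X) pos \<gamma>" "pos y \<in> drawing X (induced E X) pos \<gamma>"
    using assms by (auto simp: drawing_def)
  ultimately show thesis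
    using path_connected_drawing[OF emb sg con] that unfolding path_connected_arcwise by metis
qed

lemma plane_embedding_add_edge:
  assumes emb: "plane_embedding V E pos \<gamma>" and sg: "simple_graph V E" and "x \<in> V" "y \<in> V" "{x, y} \<notin> E"
    and g: "arc g" "pathstart g = pos x" "pathfinish g = pos y" "path_image g \<inter> drawing V E pos \<gamma> = {pos x, pos y}"
  shows "plane_embedding V (insert {x, y} E) pos (\<gamma>({x, y} := g))"
proof -
  have inj: "inj_on pos V" using emb by (simp add: plane_embedding_def)
  have gV: "path_image g \<inter> pos ` V = pos ` {x, y}"
  proof -
    have "path_image g \<inter> pos ` V \<subseteq> {pos x, pos y}" using g(4) by (auto simp: drawing_def)
    moreover have "{pos x, pos y} \<subseteq> path_image g \<inter> pos ` V" using g(4) assms(3,4) by auto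
    ultimately show ?thesis by simp
  qed
  have ge: "path_image g \<inter> path_image (\<gamma> e) = pos ` (e \<inter> {x, y})" if "e \<in> E" for e
  proof -
    have e: "path_image (\<gamma> e) \<inter> pos ` V = pos ` e" "e \<subseteq> V"
      using plane_embeddingD(4)[OF emb that] sg that by (auto simp: simple_graph_def)
    have "path_image g \<inter> path_image (\<gamma> e) = (path_image g \<inter> drawing V E pos \<gamma>) \<inter> path_image (\<gamma> e)"
      using that by (auto simp: drawing_def)
    also have "\<dots> = pos ` {x, y} \<inter> (path_image (\<gamma> e) \<inter> pos ` V)" using g(4) assms(3,4) by auto
    also have "\<dots> = pos ` (e \<inter> {x, y})" unfolding e using inj_on_image_Int[OF inj, of "{x,y}" e] e assms(3,4) by (simp add: Int_commute)
    finally show ?thesis .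
  qed
  let ?\<gamma> = "\<gamma>({x, y} := g)"
  note D = plane_embeddingD[OF emb]
  have old: "?\<gamma> e = \<gamma> e" if "e \<in> E" for e using that assms(5) by auto
  have 1: "arc (?\<gamma> e) \<and> {pathstart (?\<gamma> e), pathfinish (?\<gamma> e)} = pos ` e \<and> path_image (?\<gamma> e) \<inter> pos ` V = pos ` e"
    if "e \<in> insert {x, y} E" for e
  proof (cases "e \<in> E")
    case True then show ?thesis using D old by simp
  next
    case False then show ?thesis using that g(1,2,3) gV by simp
  qed
  have 2: "path_image (?\<gamma> e) \<inter> path_image (?\<gamma> e') = pos ` (e \<inter> e')"
    if ee: "e \<in> insert {x, y} E" "e' \<in> insert {x, y} E" "e \<noteq> e'" for e e'
  proof -
    consider "e \<in> E" "e' \<in> E" | "e = {x, y}" "e' \<in> E" | "e \<in> E" "e' = {x, y}" using ee by blast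
    then show ?thesis
    proof cases
      case 1 then show ?thesis using old D(5) ee by simp
    next
      case 2 then show ?thesis using old[of e'] ge[of e'] by (simp add: Int_commute)
    next
      case 3 then show ?thesis using old[of e] ge[of e] by (simp add: Int_commute)
    qed
  qed
  show ?thesis unfolding plane_embedding_def
  proof (intro conjI[OF inj] conjI ballI impI)
    fix e assume "e \<in> insert {x, y} E"
    from 1[OF this] show "arc (?\<gamma> e)" "{pathstart (?\<gamma> e), pathfinish (?\<gamma> e)} = pos ` e"
      "path_image (?\<gamma> e) \<inter> pos ` V = pos ` e" by blast+
  qed (rule 2)
qed

text \<open>Composing the embedding with a map that collapses \<open>g\<close> puts \<open>p\<close>
  and \<open>v\<close> in one place and identifies no other points of the drawing. Nonadjacency of
  \<open>p\<close> and \<open>v\<close> keeps every edge an arc, and the absence of common neighbors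
  keeps different edges different.\<close>

lemma planar_contract:
  assumes emb: "plane_embedding V E pos \<gamma>" and sg: "simple_graph V E" and pv: "p \<in> V" "v \<in> V" "p \<noteq> v"
    and g: "arc g" "path_image g \<inter> drawing V E pos \<gamma> = {pos p, pos v}"
    and "{p, v} \<notin> E" and common: "\<And>w. {p, w} \<in> E \<Longrightarrow> {v, w} \<notin> E"
  shows "planar (V - {p}) ((`) (id(p := v)) ` E)"
proof -
  obtain \<kappa> :: "complex \<Rightarrow> complex" where k: "continuous_on UNIV \<kappa>"
    "\<And>z. \<kappa> z = 0 \<longleftrightarrow> z \<in> path_image g" "inj_on \<kappa> (- path_image g)"
    by (rule arc_collapse[OF g(1)]) blast
  define \<rho> where "\<rho> = id(p := v)"
  note D = plane_embeddingD[OF emb]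
  have kpv: "\<kappa> (pos p) = 0" "\<kappa> (pos v) = 0" using k(2) g(2) by auto
  have krho: "\<kappa> (pos (\<rho> u)) = \<kappa> (pos u)" for u using kpv by (simp add: \<rho>_def)
  have k0: "\<kappa> (pos u) = 0 \<longleftrightarrow> u = p \<or> u = v" if "u \<in> V" for u
  proof -
    have "pos u \<in> drawing V E pos \<gamma>" using that by (auto simp: drawing_def)
    then have "pos u \<in> path_image g \<longleftrightarrow> pos u = pos p \<or> pos u = pos v" using g(2) by blast
    then show ?thesis using D(1) that pv k(2) by (metis inj_onD)
  qed
  have eV: "e \<subseteq> V" "card e = 2" if "e \<in> E" for e using sg that by (auto simp: simple_graph_def)
  \<comment> \<open>An edge can reach the collapsed point only by ending in \<open>p\<close> or
    \<open>v\<close>.\<close>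
  have ek0: "\<exists>u \<in> e \<inter> {p, v}. z = pos u" if "e \<in> E" "z \<in> path_image (\<gamma> e)" "\<kappa> z = 0" for e z
  proof -
    have "z \<in> drawing V E pos \<gamma>" using that by (auto simp: drawing_def)
    then have z: "z = pos p \<or> z = pos v" using that k(2) g(2) by blast
    then have "z \<in> pos ` e" using D(4)[OF that(1)] that(2) pv by auto
    then show ?thesis using z D(1) eV[OF that(1)] pv by (metis IntI image_iff inj_onD insertI1 insertI2 singletonI subsetD)
  qed
  have notpv: "\<not> {p, v} \<subseteq> e" if "e \<in> E" for e
  proof
    assume "{p, v} \<subseteq> e"
    moreover have "finite e" using eV[OF that] by (metis card.infinite zero_neq_numeral)
    ultimately have "{p, v} = e" using eV[OF that] pv by (intro card_seteq) auto
    then show False using that assms(8) by simp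
  qed
  have injk: "inj_on \<kappa> (path_image (\<gamma> e))" if e: "e \<in> E" for e
  proof (rule inj_onI)
    fix y z assume yz: "y \<in> path_image (\<gamma> e)" "z \<in> path_image (\<gamma> e)" "\<kappa> y = \<kappa> z"
    show "y = z"
    proof (cases "\<kappa> y = 0")
      case True
      then obtain u u' where "u \<in> e \<inter> {p, v}" "y = pos u" "u' \<in> e \<inter> {p, v}" "z = pos u'"
        using ek0[OF e] yz by metis
      then show ?thesis using notpv[OF e] by auto
    next
      case False
      then show ?thesis using yz k(2,3) by (metis ComplI inj_onD)
    qed
  qed
  \<comment> \<open>Two edges could merge only as \<open>{p, w}\<close> and \<open>{v, w}\<close>,
    which would make \<open>w\<close> a common neighbor.\<close>
  have injE: "inj_on ((`) \<rho>) E"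
  proof (rule inj_onI)
    have **: False if ee: "e \<in> E" "e' \<in> E" "\<rho> ` e = \<rho> ` e'" "p \<in> e" "p \<notin> e'" for e e'
    proof -
      obtain w where w: "e = {p, w}" "w \<noteq> p" using simple_graph_edgeE[OF sg ee(1)] ee(4) by blast
      then have "w \<noteq> v" using ee(1) assms(8) by auto
      have "\<rho> ` e' = e'" using ee(5) by (auto simp: \<rho>_def)
      moreover have "\<rho> ` e = {v, w}" using w by (auto simp: \<rho>_def)
      ultimately show False using common w ee by metis
    qed
    have *: "e \<subseteq> e'" if ee: "e \<in> E" "e' \<in> E" "\<rho> ` e = \<rho> ` e'" for e e'
    proof
      fix u assume u: "u \<in> e"
      then have "\<rho> u \<in> \<rho> ` e'" using ee(3) by (metis imageI)
      then obtain u' where u': "u' \<in> e'" "\<rho> u = \<rho> u'" by blast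
      have "p \<in> e \<longleftrightarrow> p \<in> e'" using ** ee by metis
      then show "u \<in> e'" using u u' notpv[OF ee(1)] notpv[OF ee(2)] by (auto simp: \<rho>_def split: if_splits)
    qed
    fix e e' assume "e \<in> E" "e' \<in> E" "\<rho> ` e = \<rho> ` e'"
    then show "e = e'" using *[of e e'] *[of e' e] by auto
  qed
  \<comment> \<open>Each new edge has exactly one original edge, whose collapsed arc it takes
    over.\<close>
  define \<gamma>' where "\<gamma>' = (\<lambda>e'. \<kappa> \<circ> \<gamma> (the_inv_into E ((`) \<rho>) e'))"
  have g': "\<gamma>' (\<rho> ` e) = \<kappa> \<circ> \<gamma> e" if "e \<in> E" for e
    using the_inv_into_f_f[OF injE that] by (simp add: \<gamma>'_def)
  have posr: "(\<kappa> \<circ> pos) ` (\<rho> ` e) = \<kappa> ` (pos ` e)" for e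
    using krho by (auto simp: image_iff)
  have sub: "pos ` e \<subseteq> path_image (\<gamma> e)" if "e \<in> E" for e using D(4)[OF that] by auto
  have "plane_embedding (V - {p}) ((`) \<rho> ` E) (\<kappa> \<circ> pos) \<gamma>'"
    unfolding plane_embedding_def
  proof (intro conjI ballI impI)
    show "inj_on (\<kappa> \<circ> pos) (V - {p})"
    proof (rule inj_onI)
      fix x y assume xy: "x \<in> V - {p}" "y \<in> V - {p}" "(\<kappa> \<circ> pos) x = (\<kappa> \<circ> pos) y"
      show "x = y"
      proof (cases "\<kappa> (pos x) = 0")
        case True then show ?thesis using k0 xy by auto
      next
        case False
        then have "pos x = pos y" using xy k(2,3) by (metis ComplI comp_apply inj_onD)
        then show ?thesis using D(1) xy by (meson DiffD1 inj_onD)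
      qed
    qed
  next
    fix d assume "d \<in> (`) \<rho> ` E"
    then obtain e where e: "e \<in> E" "d = \<rho> ` e" by blast
    have "path (\<kappa> \<circ> \<gamma> e)"
      using D(2)[OF e(1)] k(1) by (intro path_continuous_image) (auto simp: arc_imp_path elim: continuous_on_subset)
    moreover have "inj_on (\<kappa> \<circ> \<gamma> e) {0..1}"
      using D(2)[OF e(1)] injk[OF e(1)] by (intro comp_inj_on) (auto simp: arc_def path_image_def)
    ultimately show "arc (\<gamma>' d)" using g' e by (simp add: arc_def)
    show "{pathstart (\<gamma>' d), pathfinish (\<gamma>' d)} = (\<kappa> \<circ> pos) ` d"
      unfolding e(2) g'[OF e(1)] posr D(3)[OF e(1), symmetric] by (simp add: pathstart_compose pathfinish_compose)
    show "path_image (\<gamma>' d) \<inter> (\<kappa> \<circ> pos) ` (V - {p}) = (\<kappa> \<circ> pos) ` d"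
    proof (rule antisym)
      show "(\<kappa> \<circ> pos) ` d \<subseteq> path_image (\<gamma>' d) \<inter> (\<kappa> \<circ> pos) ` (V - {p})"
      proof -
        have "\<rho> ` e \<subseteq> V - {p}" using eV[OF e(1)] pv by (auto simp: \<rho>_def)
        moreover have "(\<kappa> \<circ> pos) ` d \<subseteq> path_image (\<gamma>' d)"
          unfolding e(2) g'[OF e(1)] posr path_image_compose using sub[OF e(1)] by (rule image_mono)
        ultimately show ?thesis unfolding e(2) by blast
      qed
      show "path_image (\<gamma>' d) \<inter> (\<kappa> \<circ> pos) ` (V - {p}) \<subseteq> (\<kappa> \<circ> pos) ` d"
        unfolding e(2) g'[OF e(1)] posr path_image_compose
      proof
        fix y assume "y \<in> \<kappa> ` path_image (\<gamma> e) \<inter> (\<kappa> \<circ> pos) ` (V - {p})"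
        then obtain z u where zu: "z \<in> path_image (\<gamma> e)" "u \<in> V - {p}" "y = \<kappa> z" "y = \<kappa> (pos u)"
          unfolding image_comp[symmetric] by blast
        show "y \<in> \<kappa> ` pos ` e"
        proof (cases "y = 0")
          case True
          then obtain u' where "u' \<in> e" "z = pos u'" using ek0[OF e(1) zu(1)] zu(3) by auto
          then show ?thesis using zu(3) by blast
        next
          case False
          then have "z = pos u" using zu k(2,3) by (metis ComplI inj_onD)
          then have "z \<in> pos ` e" using D(4)[OF e(1)] zu(1,2) by blast
          then show ?thesis using zu(3) by blast
        qed
      qed
    qed
    fix d' assume "d' \<in> (`) \<rho> ` E" "d \<noteq> d'"
    then obtain e' where e': "e' \<in> E" "d' = \<rho> ` e'" "e \<noteq> e'" using e by blast
    show "path_image (\<gamma>' d) \<inter> path_image (\<gamma>' d') = (\<kappa> \<circ> pos) ` (d \<inter> d')"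
    proof (rule antisym)
      show "path_image (\<gamma>' d) \<inter> path_image (\<gamma>' d') \<subseteq> (\<kappa> \<circ> pos) ` (d \<inter> d')"
        unfolding e(2) e'(2) g'[OF e(1)] g'[OF e'(1)] path_image_compose
      proof
        fix y assume "y \<in> \<kappa> ` path_image (\<gamma> e) \<inter> \<kappa> ` path_image (\<gamma> e')"
        then obtain z z' where z: "z \<in> path_image (\<gamma> e)" "z' \<in> path_image (\<gamma> e')" "y = \<kappa> z" "y = \<kappa> z'" by auto
        show "y \<in> (\<kappa> \<circ> pos) ` (\<rho> ` e \<inter> \<rho> ` e')"
        proof (cases "y = 0")
          case True
          then obtain u u' where "u \<in> e \<inter> {p, v}" "u' \<in> e' \<inter> {p, v}"
            using ek0[OF e(1) z(1)] ek0[OF e'(1) z(2)] z by metis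
          then have "v \<in> \<rho> ` e \<inter> \<rho> ` e'" by (auto simp: \<rho>_def image_iff)
          then show ?thesis using True kpv(2) by (metis comp_apply image_eqI)
        next
          case False
          then have "z = z'" using z k(2,3) by (metis ComplI inj_onD)
          then obtain u where "u \<in> e \<inter> e'" "z = pos u" using D(5)[OF e(1) e'(1) e'(3)] z by blast
          then have "\<rho> u \<in> \<rho> ` e \<inter> \<rho> ` e'" "y = (\<kappa> \<circ> pos) (\<rho> u)" using z(3) krho by auto
          then show ?thesis by blast
        qed
      qed
      have "(\<kappa> \<circ> pos) ` d \<subseteq> path_image (\<gamma>' d)" "(\<kappa> \<circ> pos) ` d' \<subseteq> path_image (\<gamma>' d')"
        unfolding e(2) e'(2) g'[OF e(1)] g'[OF e'(1)] posr path_image_compose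
        using sub[OF e(1)] sub[OF e'(1)] by (auto intro!: image_mono)
      then show "(\<kappa> \<circ> pos) ` (d \<inter> d') \<subseteq> path_image (\<gamma>' d) \<inter> path_image (\<gamma>' d')" by blast
    qed
  qed
  then show ?thesis unfolding planar_def \<rho>_def by blast
qed

section \<open>List colorings\<close>

definition nbrs :: "'a set set \<Rightarrow> 'a \<Rightarrow> 'a set" where
  "nbrs E u = {w. {u, w} \<in> E}"

lemma nbrs_sym: "w \<in> nbrs E u \<longleftrightarrow> u \<in> nbrs E w"
  by (simp add: nbrs_def insert_commute)

lemma nbrs_simple:
  assumes "simple_graph V E"
  shows "u \<notin> nbrs E u" "nbrs E u \<subseteq> V" "finite (nbrs E u)" "w \<in> nbrs E u \<Longrightarrow> u \<in> V"
proof -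
  show "u \<notin> nbrs E u" "nbrs E u \<subseteq> V" "w \<in> nbrs E u \<Longrightarrow> u \<in> V"
    using assms by (auto simp: nbrs_def simple_graph_def)
  then show "finite (nbrs E u)" using assms by (auto simp: simple_graph_def intro: finite_subset)
qed

lemma vdegree_nbrs:
  assumes "simple_graph V E"
  shows "vdegree E v = card (nbrs E v)"
proof -
  have "bij_betw (\<lambda>w. {v, w}) (nbrs E v) {e \<in> E. v \<in> e}"
  proof (rule bij_betwI')
    fix e assume e: "e \<in> {e \<in> E. v \<in> e}"
    then obtain u w where "e = {u, w}" using simple_graph_edgeE[OF assms, of e] by blast
    then show "\<exists>w\<in>nbrs E v. e = {v, w}"
      using e by (auto simp: nbrs_def insert_commute)
  qed (auto simp: nbrs_def doubleton_eq_iff)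
  then show ?thesis
    unfolding vdegree_def by (metis bij_betw_same_card)
qed

definition list_coloring :: "'a set set \<Rightarrow> ('a \<Rightarrow> 'c set) \<Rightarrow> 'a set \<Rightarrow> ('a \<Rightarrow> 'c) \<Rightarrow> bool" where
  "list_coloring E L X c \<longleftrightarrow> (\<forall>u\<in>X. c u \<in> L u) \<and> (\<forall>u\<in>X. \<forall>w\<in>X. {u, w} \<in> E \<longrightarrow> c u \<noteq> c w)"

lemma list_coloring_induced:
  assumes "simple_graph V E"
  shows "list_coloring E L X c \<longleftrightarrow> (\<forall>u\<in>X. c u \<in> L u) \<and> proper_coloring (induced E X) c"
  unfolding list_coloring_def proper_coloring_def induced_def by auto

lemma list_coloring_Un:
  assumes "list_coloring E L X c" "list_coloring E L Y d" "X \<inter> Y = {}"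
    and "\<And>x y. x \<in> X \<Longrightarrow> y \<in> Y \<Longrightarrow> {x, y} \<in> E \<Longrightarrow> c x \<noteq> d y"
  shows "list_coloring E L (X \<union> Y) (\<lambda>u. if u \<in> X then c u else d u)"
  unfolding list_coloring_def
proof (intro conjI ballI impI)
  fix u assume "u \<in> X \<union> Y"
  then show "(if u \<in> X then c u else d u) \<in> L u" using assms by (auto simp: list_coloring_def)
next
  fix u w assume u: "u \<in> X \<union> Y" and w: "w \<in> X \<union> Y" and e: "{u, w} \<in> E"
  have e': "{w, u} \<in> E" using e by (simp add: insert_commute)
  show "(if u \<in> X then c u else d u) \<noteq> (if w \<in> X then c w else d w)"
    using assms(1,2) assms(4)[of u w] assms(4)[of w u] u w e e' unfolding list_coloring_def by auto
qed

text \<open>A vertex with a spare color is set aside and colored last. Each of its neighbors then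
  has one competitor fewer and acquires a spare color itself, so every closed-off part of the
  remaining set still contains a vertex with a spare color and induction applies.\<close>

lemma greedy_list_coloring:
  assumes "finite S" and "\<And>u. {u} \<notin> E"
    and "\<And>u. u \<in> S \<Longrightarrow> finite (L u) \<and> card (nbrs E u \<inter> S) \<le> card (L u)"
    and "\<And>X. X \<subseteq> S \<Longrightarrow> X \<noteq> {} \<Longrightarrow> (\<forall>x\<in>X. \<forall>y\<in>S - X. {x, y} \<notin> E) \<Longrightarrow>
           \<exists>x\<in>X. card (nbrs E x \<inter> S) < card (L x)"
  shows "\<exists>c. list_coloring E L S c"
  using assms
proof (induction "card S" arbitrary: S)
  case 0
  then show ?case by (auto simp: list_coloring_def)
next
  case (Suc n)
  note fin = \<open>finite S\<close> and loopless = Suc.prems(2) and deg = Suc.prems(3) and exc = Suc.prems(4)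
  have "S \<noteq> {}" using Suc.hyps(2) by auto
  then obtain u where u: "u \<in> S" "card (nbrs E u \<inter> S) < card (L u)"
    using exc[of S] by blast
  define S' where "S' = S - {u}"
  have S': "finite S'" "S' \<subseteq> S" "card S' = n" using fin u Suc.hyps(2) by (auto simp: S'_def)
  have le: "card (nbrs E x \<inter> S') \<le> card (nbrs E x \<inter> S)" for x
    using fin S' by (intro card_mono) auto
  have "\<exists>c. list_coloring E L S' c"
  proof (rule Suc.hyps(1))
    fix x assume "x \<in> S'"
    then show "finite (L x) \<and> card (nbrs E x \<inter> S') \<le> card (L x)"
      using deg[of x] le[of x] S' by auto
  next
    fix X assume X: "X \<subseteq> S'" "X \<noteq> {}" "\<forall>x\<in>X. \<forall>y\<in>S' - X. {x, y} \<notin> E"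
    show "\<exists>x\<in>X. card (nbrs E x \<inter> S') < card (L x)"
    proof (cases "\<exists>x\<in>X. {x, u} \<in> E")
      case True
      then obtain x where x: "x \<in> X" "u \<in> nbrs E x" by (auto simp: nbrs_def)
      have "nbrs E x \<inter> S' \<subset> nbrs E x \<inter> S" using x u by (auto simp: S'_def)
      then have "card (nbrs E x \<inter> S') < card (nbrs E x \<inter> S)" using fin by (intro psubset_card_mono) auto
      then show ?thesis using x deg[of x] X(1) S'(2) by (meson less_le_trans subsetD)
    next
      case False
      then have cl: "\<forall>x\<in>X. \<forall>y\<in>S - X. {x, y} \<notin> E" using X(3) by (auto simp: S'_def)
      have "X \<subseteq> S" using X(1) S' by auto
      then obtain x where "x \<in> X" "card (nbrs E x \<inter> S) < card (L x)"
        using exc[OF _ X(2) cl] by blast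
      then show ?thesis using le[of x] by (meson le_less_trans)
    qed
  qed (use S' loopless in auto)
  then obtain c where c: "list_coloring E L S' c" by blast
  have "card (c ` (nbrs E u \<inter> S')) \<le> card (nbrs E u \<inter> S')" using S' by (intro card_image_le) auto
  then have "card (c ` (nbrs E u \<inter> S')) < card (L u)" using le[of u] u(2) by linarith
  then have "\<not> L u \<subseteq> c ` (nbrs E u \<inter> S')"
    using S'(1) by (meson card_mono finite_Int finite_imageI leD)
  then obtain a where a: "a \<in> L u" "a \<notin> c ` (nbrs E u \<inter> S')" by blast
  have "list_coloring E L ({u} \<union> S') (\<lambda>x. if x \<in> {u} then a else c x)"
    using c a loopless by (intro list_coloring_Un) (auto simp: list_coloring_def nbrs_def S'_def)
  moreover have "{u} \<union> S' = S" using u by (auto simp: S'_def)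
  ultimately show ?case by auto
qed

text \<open>Deleting from each list on \<open>S\<close> the colors of neighbors in \<open>R\<close>
  leaves at least as many colors as there are neighbors in \<open>S\<close>. A neighbor colored off
  the list, or two neighbors of equal color, produce the spare color that the greedy coloring asks
  for.\<close>

lemma extend_list_coloring:
  assumes sg: "simple_graph V E" and "finite S" "R \<inter> S = {}" and R: "list_coloring E L R \<phi>"
    and deg: "\<And>u. u \<in> S \<Longrightarrow> finite (L u) \<and> card (nbrs E u \<inter> (R \<union> S)) \<le> card (L u)"
    and exc: "\<And>X. X \<subseteq> S \<Longrightarrow> X \<noteq> {} \<Longrightarrow> (\<forall>x\<in>X. \<forall>y\<in>S - X. {x, y} \<notin> E) \<Longrightarrow>
       \<exists>x\<in>X. (\<exists>q \<in> nbrs E x \<inter> R. \<phi> q \<notin> L x) \<or> (\<exists>q \<in> nbrs E x \<inter> R. \<exists>q' \<in> nbrs E x \<inter> R. q \<noteq> q' \<and> \<phi> q = \<phi> q')"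
  shows "\<exists>c. list_coloring E L (R \<union> S) c"
proof -
  define L' where "L' = (\<lambda>u. L u - \<phi> ` (nbrs E u \<inter> R))"
  note N = nbrs_simple[OF sg]
  have split: "card (nbrs E u \<inter> (R \<union> S)) = card (nbrs E u \<inter> R) + card (nbrs E u \<inter> S)" for u
    using assms(3) N(3) by (subst card_Un_disjoint[symmetric]) (auto simp: Int_Un_distrib)
  have cL': "card (L' u) = card (L u) - card (L u \<inter> \<phi> ` (nbrs E u \<inter> R))" if "u \<in> S" for u
    unfolding L'_def using deg[OF that] card_Diff_subset_Int[of "L u" "\<phi> ` (nbrs E u \<inter> R)"] by auto
  have bound: "card (L u \<inter> \<phi> ` A) \<le> card A" if "finite A" for u A
    using that by (meson card_image_le card_mono finite_imageI inf_le2 le_trans)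
  have "\<exists>c. list_coloring E L' S c"
  proof (rule greedy_list_coloring)
    show "finite S" by fact
    show "{u} \<notin> E" for u using sg by (auto simp: simple_graph_def)
    show "finite (L' u) \<and> card (nbrs E u \<inter> S) \<le> card (L' u)" if "u \<in> S" for u
      using deg[OF that] split[of u] cL'[OF that] bound[of "nbrs E u \<inter> R" u] N(3) by (auto simp: L'_def)
  next
    fix X assume X: "X \<subseteq> S" "X \<noteq> {}" "\<forall>x\<in>X. \<forall>y\<in>S - X. {x, y} \<notin> E"
    then obtain x where x: "x \<in> X" and
      c: "(\<exists>q \<in> nbrs E x \<inter> R. \<phi> q \<notin> L x) \<or> (\<exists>q \<in> nbrs E x \<inter> R. \<exists>q' \<in> nbrs E x \<inter> R. q \<noteq> q' \<and> \<phi> q = \<phi> q')"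
      using exc[OF X] by blast
    \<comment> \<open>The neighbor \<open>q\<close> costs \<open>x\<close> nothing, since its color
      is off the list of \<open>x\<close> or is also used by another neighbor; so fewer colors are
      deleted at \<open>x\<close> than it has neighbors in \<open>R\<close>.\<close>
    have "\<exists>q \<in> nbrs E x \<inter> R. L x \<inter> \<phi> ` (nbrs E x \<inter> R) \<subseteq> L x \<inter> \<phi> ` (nbrs E x \<inter> R - {q})"
      using c
    proof
      assume "\<exists>q \<in> nbrs E x \<inter> R. \<phi> q \<notin> L x"
      then show ?thesis by blast
    next
      assume "\<exists>q \<in> nbrs E x \<inter> R. \<exists>q' \<in> nbrs E x \<inter> R. q \<noteq> q' \<and> \<phi> q = \<phi> q'"
      then obtain q q' where q: "q \<in> nbrs E x \<inter> R" "q' \<in> nbrs E x \<inter> R" "q \<noteq> q'" "\<phi> q = \<phi> q'"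
        by (elim bexE conjE)
      have "\<phi> t \<in> \<phi> ` (nbrs E x \<inter> R - {q})" if "t \<in> nbrs E x \<inter> R" for t
        using that q by (cases "t = q") (auto simp: image_iff)
      then have "\<phi> ` (nbrs E x \<inter> R) \<subseteq> \<phi> ` (nbrs E x \<inter> R - {q})" by (rule image_subsetI)
      then have "L x \<inter> \<phi> ` (nbrs E x \<inter> R) \<subseteq> L x \<inter> \<phi> ` (nbrs E x \<inter> R - {q})" by (rule Int_mono[OF order_refl])
      with q(1) show ?thesis by (rule bexI[rotated])
    qed
    then obtain q where q: "q \<in> nbrs E x \<inter> R"
      "L x \<inter> \<phi> ` (nbrs E x \<inter> R) \<subseteq> L x \<inter> \<phi> ` (nbrs E x \<inter> R - {q})" by blast
    have "card (L x \<inter> \<phi> ` (nbrs E x \<inter> R)) \<le> card (L x \<inter> \<phi> ` (nbrs E x \<inter> R - {q}))"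
      using q(2) N(3) by (intro card_mono) auto
    also have "\<dots> \<le> card (nbrs E x \<inter> R - {q})" using N(3) by (intro bound) auto
    also have "\<dots> < card (nbrs E x \<inter> R)" using q(1) N(3) by (meson card_Diff1_less finite_Int)
    finally have "card (L x \<inter> \<phi> ` (nbrs E x \<inter> R)) < card (nbrs E x \<inter> R)" .
    moreover have xS: "x \<in> S" using X(1) x by blast
    ultimately have "card (nbrs E x \<inter> S) < card (L' x)"
      using deg[OF xS] split[of x] cL'[OF xS] by linarith
    then show "\<exists>x\<in>X. card (nbrs E x \<inter> S) < card (L' x)" using x by blast
  qed
  then obtain c where c: "list_coloring E L' S c" by blast
  have "list_coloring E L (R \<union> S) (\<lambda>u. if u \<in> R then \<phi> u else c u)"
  proof (rule list_coloring_Un[OF R _ assms(3)])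
    show "list_coloring E L S c" using c by (auto simp: list_coloring_def L'_def)
    fix x y assume xy: "x \<in> R" "y \<in> S" "{x, y} \<in> E"
    then have "x \<in> nbrs E y \<inter> R" by (simp add: nbrs_def insert_commute)
    then have "\<phi> x \<in> \<phi> ` (nbrs E y \<inter> R)" by (rule imageI)
    moreover have "c y \<in> L' y" using c xy by (simp add: list_coloring_def)
    ultimately show "\<phi> x \<noteq> c y" unfolding L'_def by (metis DiffD2)
  qed
  then show ?thesis by blast
qed

section \<open>Renaming vertices and renaming colors\<close>

lemma plane_embedding_relabel:
  assumes emb: "plane_embedding V E pos \<gamma>" and sg: "simple_graph V E" and f: "inj_on f V"
  shows "plane_embedding (f ` V) ((`) f ` E) (pos \<circ> the_inv_into V f) (\<lambda>e. \<gamma> (the_inv_into V f ` e))"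
proof -
  let ?g = "the_inv_into V f"
  have g: "?g (f u) = u" if "u \<in> V" for u using that f by (simp add: the_inv_into_f_f)
  have eV: "e \<subseteq> V" if "e \<in> E" for e using sg that by (auto simp: simple_graph_def)
  have gi: "?g ` f ` X = X" if "X \<subseteq> V" for X using that g by (force simp: image_image)
  note D = plane_embeddingD[OF emb]
  have pos: "(pos \<circ> ?g) ` f ` X = pos ` X" if "X \<subseteq> V" for X
    using gi[OF that] by (metis image_comp)
  show ?thesis
    unfolding plane_embedding_def
  proof (intro conjI ballI impI)
    show "inj_on (pos \<circ> ?g) (f ` V)"
      using D(1) gi[of V] f by (intro comp_inj_on) (auto simp: inj_on_the_inv_into)
    fix d assume "d \<in> (`) f ` E"
    then obtain e where e: "e \<in> E" "d = f ` e" by blast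
    show "arc (\<gamma> (?g ` d))" "{pathstart (\<gamma> (?g ` d)), pathfinish (\<gamma> (?g ` d))} = (pos \<circ> ?g) ` d"
      "path_image (\<gamma> (?g ` d)) \<inter> (pos \<circ> ?g) ` f ` V = (pos \<circ> ?g) ` d"
      using D(2-4)[OF e(1)] unfolding e(2) by (simp_all only: gi pos eV[OF e(1)] order_refl)
    fix d' assume "d' \<in> (`) f ` E" "d \<noteq> d'"
    then obtain e' where e': "e' \<in> E" "d' = f ` e'" "e \<noteq> e'" using e by blast
    have "f ` e \<inter> f ` e' = f ` (e \<inter> e')"
      using f eV[OF e(1)] eV[OF e'(1)] by (metis inj_on_image_Int)
    moreover have "e \<inter> e' \<subseteq> V" using eV[OF e(1)] by auto
    ultimately show "path_image (\<gamma> (?g ` d)) \<inter> path_image (\<gamma> (?g ` d')) = (pos \<circ> ?g) ` (d \<inter> d')"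
      using D(5)[OF e(1) e'(1,3)] unfolding e(2) e'(2) by (simp only: gi pos eV[OF e(1)] eV[OF e'(1)])
  qed
qed

text \<open>The competitors in the definition of minimality live on natural numbers. A smaller graph
  on any vertex type is copied there, and the coloring of the copy is pulled back.\<close>

lemma minimal_choosable:
  fixes W :: "'b set" and V :: "'a set"
  assumes "minimal_non_choosable_planar k V E"
    and W: "simple_graph W D" "planar W D" "card W < card V"
  shows "choosable k W D"
proof -
  obtain f :: "'b \<Rightarrow> nat" where f: "inj_on f W"
    using W(1) finite_imp_inj_to_nat_seg unfolding simple_graph_def by metis
  let ?D = "(`) f ` D"
  have DW: "e \<subseteq> W" "card e = 2" if "e \<in> D" for e using that W(1) by (auto simp: simple_graph_def)
  have "simple_graph (f ` W) ?D"
    using W(1) DW f unfolding simple_graph_def by (auto simp: card_image inj_on_subset)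
  moreover have "planar (f ` W) ?D"
    using W plane_embedding_relabel[OF _ W(1) f] unfolding planar_def by blast
  moreover have "card (f ` W) < card V" using W(3) f by (simp add: card_image)
  ultimately have ch: "choosable k (f ` W) ?D"
    using assms(1) unfolding minimal_non_choosable_planar_def by (meson not_le)
  show ?thesis
    unfolding choosable_def
  proof (intro allI impI)
    fix L :: "'b \<Rightarrow> nat set" assume L: "\<forall>v\<in>W. finite (L v) \<and> card (L v) = k"
    define L' where "L' = (\<lambda>n. L (the_inv_into W f n))"
    have L': "L' (f u) = L u" if "u \<in> W" for u using that f by (simp add: L'_def the_inv_into_f_f)
    have "\<forall>v\<in>f ` W. finite (L' v) \<and> card (L' v) = k" using L L' by auto
    then obtain c where c: "\<forall>v\<in>f ` W. c v \<in> L' v" "proper_coloring ?D c"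
      using ch unfolding choosable_def by blast
    have "proper_coloring D (c \<circ> f)"
      unfolding proper_coloring_def
    proof (intro allI impI)
      fix u w assume "{u, w} \<in> D"
      then have "f ` {u, w} \<in> ?D" by blast
      then show "(c \<circ> f) u \<noteq> (c \<circ> f) w" using c(2) by (simp add: proper_coloring_def)
    qed
    then show "\<exists>c. (\<forall>v\<in>W. c v \<in> L v) \<and> proper_coloring D c"
      using c(1) L' by (intro exI[of _ "c \<circ> f"]) auto
  qed
qed

text \<open>The size condition leaves room to send \<open>P\<close> into \<open>B - Q\<close>. The
  rest of \<open>A\<close> is matched with the rest of \<open>B\<close>, and all other colors are
  moved beyond \<open>B\<close> so that the renaming is injective everywhere.\<close>

lemma recoloring:
  fixes A B P Q :: "nat set"
  assumes "finite A" "finite B" "card A = card B" "P \<subseteq> A" "Q \<subseteq> B" "card P + card Q \<le> card B"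
  obtains \<sigma> :: "nat \<Rightarrow> nat" where "inj \<sigma>" "\<sigma> ` A = B" "\<sigma> ` P \<inter> Q = {}"
proof -
  have fin: "finite P" "finite Q" using assms finite_subset by auto
  have "card P \<le> card (B - Q)" using assms fin by (simp add: card_Diff_subset)
  then obtain f1 where f1: "inj_on f1 P" "f1 ` P \<subseteq> B - Q"
    using card_le_inj[OF fin(1)] assms(2) by (metis finite_Diff)
  have "card (A - P) = card (B - f1 ` P)"
  proof -
    have "f1 ` P \<subseteq> B" using f1 by auto
    then show ?thesis using assms fin f1 by (simp add: card_Diff_subset card_image)
  qed
  then obtain f2 where f2: "bij_betw f2 (A - P) (B - f1 ` P)"
    using assms finite_same_card_bij by (metis finite_Diff)
  \<comment> \<open>Larger than every element of \<open>B\<close>, so a shift by \<open>N\<close>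
    cannot land in \<open>B\<close>.\<close>
  define N where "N = Suc (Max B)"
  define \<sigma> where "\<sigma> x = (if x \<in> P then f1 x else if x \<in> A then f2 x else x + N)" for x
  have im: "\<sigma> x \<in> B \<longleftrightarrow> x \<in> A" for x
  proof (cases "x \<in> A")
    case True
    then show ?thesis using f1(2) f2 assms(4) by (auto simp: \<sigma>_def bij_betw_def)
  next
    case False
    have "x + N \<notin> B" using Max_ge[OF assms(2), of "x + N"] by (auto simp: N_def)
    then show ?thesis using False assms(4) by (auto simp: \<sigma>_def)
  qed
  have inP: "\<sigma> x \<in> f1 ` P \<longleftrightarrow> x \<in> P" for x
  proof (cases "x \<in> A")
    case True
    then show ?thesis using f2 by (auto simp: \<sigma>_def bij_betw_def)
  next
    case False
    then have "\<sigma> x \<notin> B" using im by auto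
    then show ?thesis using f1(2) assms(4) False by auto
  qed
  have "inj \<sigma>"
  proof (rule injI)
    fix x y assume e: "\<sigma> x = \<sigma> y"
    have A: "x \<in> A \<longleftrightarrow> y \<in> A" and P: "x \<in> P \<longleftrightarrow> y \<in> P" using im inP e by metis+
    consider "x \<in> P" | "x \<in> A - P" | "x \<notin> A" by blast
    then show "x = y"
    proof cases
      case 1 then show ?thesis using P e f1(1) by (simp add: \<sigma>_def inj_on_eq_iff)
    next
      case 2
      then have "y \<in> A - P" "f2 x = f2 y" using A P e by (auto simp: \<sigma>_def)
      then show ?thesis using 2 f2 by (metis bij_betw_imp_inj_on inj_onD)
    next
      case 3 then show ?thesis using A P e assms(4) by (auto simp: \<sigma>_def split: if_splits)
    qed
  qed
  moreover have "\<sigma> ` A = B"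
  proof (rule card_seteq)
    show "\<sigma> ` A \<subseteq> B" using im by auto
    show "card B \<le> card (\<sigma> ` A)" using assms(3) \<open>inj \<sigma>\<close> by (simp add: card_image inj_on_subset)
  qed fact
  moreover have "\<sigma> ` P \<inter> Q = {}" using f1(2) by (auto simp: \<sigma>_def)
  ultimately show thesis by (rule that)
qed

section \<open>Minimal counterexamples\<close>

locale bad_lists =
  fixes V :: "'a set" and E :: "'a set set" and pos :: "'a \<Rightarrow> complex" and \<gamma> :: "'a set \<Rightarrow> real \<Rightarrow> complex"
    and L :: "'a \<Rightarrow> nat set"
  assumes minimal: "minimal_non_choosable_planar 4 V E"
    and emb: "plane_embedding V E pos \<gamma>"
    and lists: "v \<in> V \<Longrightarrow> finite (L v) \<and> card (L v) = 4"
    and no_coloring: "\<not> list_coloring E L V c"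
begin

lemma sg: "simple_graph V E" and planar: "planar V E"
  using minimal by (auto simp: minimal_non_choosable_planar_def)

lemma finite_V: "finite V"
  using sg by (simp add: simple_graph_def)

lemmas N = nbrs_simple[OF sg]

lemma no_loop: "{u} \<notin> E"
  using sg by (auto simp: simple_graph_def)

lemma proper_subset_coloring:
  assumes "X \<subset> V" "\<And>u. u \<in> X \<Longrightarrow> finite (L' u) \<and> card (L' u) = 4"
  obtains c :: "'a \<Rightarrow> nat" where "list_coloring E L' X c"
proof -
  have X: "X \<subseteq> V" "\<Union>(induced E X) \<subseteq> X" using assms(1) by (auto simp: induced_def)
  have "choosable 4 X (induced E X)"
  proof (rule minimal_choosable[OF minimal])
    show "simple_graph X (induced E X)"
      using simple_graph_subset[OF sg X(1) induced_mono X(2)] .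
    show "planar X (induced E X)"
      using planar_subset[OF planar X(1) induced_mono X(2)] .
    show "card X < card V" using assms(1) finite_V by (rule psubset_card_mono[rotated])
  qed
  then show thesis
    using that assms(2) list_coloring_induced[OF sg] unfolding choosable_def by blast
qed

text \<open>The form in which reducibility is used: on vertices of degree at most 4, a coloring of
  the remaining graph extends as soon as every closed-off part of \<open>S\<close> has a vertex that
  sees an unlisted or a repeated color. Since the lists admit no coloring, this is a
  contradiction.\<close>

lemma extend_to_V:
  assumes "S \<subseteq> V" "list_coloring E L (V - S) \<phi>" "\<And>u. u \<in> S \<Longrightarrow> card (nbrs E u) \<le> 4"
    and "\<And>X. X \<subseteq> S \<Longrightarrow> X \<noteq> {} \<Longrightarrow> (\<forall>x\<in>X. \<forall>y\<in>S - X. {x, y} \<notin> E) \<Longrightarrow>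
       \<exists>x\<in>X. (\<exists>q \<in> nbrs E x - S. \<phi> q \<notin> L x) \<or> (\<exists>q \<in> nbrs E x - S. \<exists>q' \<in> nbrs E x - S. q \<noteq> q' \<and> \<phi> q = \<phi> q')"
  shows False
proof -
  have eq: "nbrs E x \<inter> (V - S) = nbrs E x - S" "nbrs E x \<inter> V = nbrs E x" for x using N(2) by auto
  have V: "V - S \<union> S = V" using assms(1) by auto
  have "\<exists>c. list_coloring E L (V - S \<union> S) c"
  proof (rule extend_list_coloring[OF sg _ _ assms(2)])
    show "finite S" using assms(1) finite_V finite_subset by auto
    show "(V - S) \<inter> S = {}" by auto
    show "finite (L u) \<and> card (nbrs E u \<inter> (V - S \<union> S)) \<le> card (L u)" if "u \<in> S" for u
      using assms(1) assms(3)[OF that] lists that unfolding V eq by auto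
  qed (use assms(4) in \<open>simp only: eq\<close>)
  then show False using no_coloring V by metis
qed

text \<open>A coloring of all other vertices would leave a color free at a vertex of smaller
  degree.\<close>

lemma min_degree:
  assumes "u \<in> V"
  shows "4 \<le> card (nbrs E u)"
proof (rule ccontr)
  assume *: "\<not> 4 \<le> card (nbrs E u)"
  obtain c where c: "list_coloring E L (V - {u}) c"
    by (rule proper_subset_coloring[of "V - {u}" L]) (use assms lists in auto)
  have "card (c ` nbrs E u) < card (L u)"
    using * card_image_le[OF N(3), of c u] lists[OF assms] by linarith
  then have "\<not> L u \<subseteq> c ` nbrs E u"
    using N(3) by (meson card_mono finite_imageI leD)
  then obtain a where a: "a \<in> L u" "a \<notin> c ` nbrs E u" by blast
  have "list_coloring E L ({u} \<union> (V - {u})) (\<lambda>x. if x \<in> {u} then a else c x)"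
    using a N(1)[of u] by (intro list_coloring_Un[OF _ c]) (auto simp: list_coloring_def nbrs_def)
  moreover have "{u} \<union> (V - {u}) = V" using assms by auto
  ultimately show False using no_coloring by metis
qed

text \<open>Two sides without an edge between them could be colored independently.\<close>

lemma connected_V: "graph_connected E V"
  unfolding graph_connected_def
proof (intro allI impI, rule ccontr)
  fix X assume X: "X \<subseteq> V" "X \<noteq> {} \<and> X \<noteq> V" and no: "\<not> (\<exists>x\<in>X. \<exists>y\<in>V - X. {x, y} \<in> E)"
  obtain c where c: "list_coloring E L X c"
    by (rule proper_subset_coloring[of X L]) (use X lists in auto)
  obtain d where d: "list_coloring E L (V - X) d"
    by (rule proper_subset_coloring[of "V - X" L]) (use X lists in auto)
  have "list_coloring E L (X \<union> (V - X)) (\<lambda>x. if x \<in> X then c x else d x)"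
    using no by (intro list_coloring_Un[OF c d]) auto
  moreover have "X \<union> (V - X) = V" using X by auto
  ultimately show False using no_coloring by metis
qed

definition good_colors :: "'a set \<Rightarrow> 'a \<Rightarrow> nat set" where
  "good_colors X u = {c u |c. list_coloring E L X c}"

lemma good_colors_subset: "u \<in> X \<Longrightarrow> good_colors X u \<subseteq> L u"
  by (auto simp: good_colors_def list_coloring_def)

text \<open>If the two sets had at most four colors in total, the colors on \<open>M\<close> could
  be renamed so that the list of \<open>p\<close> becomes that of \<open>v\<close> while the two
  sets of good colors become disjoint. Identifying \<open>p\<close> with \<open>v\<close> through
  \<open>X\<close> gives a planar graph with fewer vertices, so it has a coloring from these lists;
  the color of the merged vertex would then belong to both sets.\<close>

lemma good_colors_glue:
  assumes M: "M \<subseteq> V" "p \<in> M" and H: "H \<subseteq> V" "v \<in> H" and "M \<inter> H = {}"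
    and X: "X \<subseteq> V" "graph_connected E X" "X \<inter> (M \<union> H) = {p, v}"
  shows "5 \<le> card (good_colors M p) + card (good_colors H v)"
proof (rule ccontr)
  assume "\<not> 5 \<le> card (good_colors M p) + card (good_colors H v)"
  then have small: "card (good_colors M p) + card (good_colors H v) \<le> 4" by simp
  \<comment> \<open>Edges between \<open>M\<close> and \<open>H\<close> are dropped, so
    \<open>p\<close> and \<open>v\<close> are nonadjacent and have no common neighbor.\<close>
  define D where "D = induced E M \<union> induced E H"
  define \<rho> where "\<rho> = id(p := v)"
  define W where "W = M \<union> H - {p}"
  have pv: "p \<noteq> v" "p \<in> V" "v \<in> V" "p \<notin> H" "v \<notin> M" using assms by auto
  have DMH: "M \<union> H \<subseteq> V" "D \<subseteq> E" "\<Union>D \<subseteq> M \<union> H" using M H by (auto simp: D_def induced_def)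
  have sgD: "simple_graph (M \<union> H) D" by (rule simple_graph_subset[OF sg DMH])
  have embD: "plane_embedding (M \<union> H) D pos \<gamma>" by (rule plane_embedding_subset[OF emb DMH])
  have sides: "e \<subseteq> M \<or> e \<subseteq> H" if "e \<in> D" for e using that by (auto simp: D_def induced_def)
  have npv: "{p, v} \<notin> D" using sides pv by blast
  have "p \<in> X" "v \<in> X" using X(3) by auto
  \<comment> \<open>The arc along which \<open>p\<close> and \<open>v\<close> are identified follows
    the edges of \<open>X\<close>; it meets the drawing of \<open>D\<close> only in its ends because
    \<open>X\<close> meets \<open>M \<union> H\<close> only in \<open>p\<close> and
    \<open>v\<close>.\<close>
  obtain g where g: "arc g" "path_image g \<subseteq> drawing X (induced E X) pos \<gamma>" "pathstart g = pos p" "pathfinish g = pos v"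
    by (rule arc_in_drawing[OF emb sg X(2,1) \<open>p \<in> X\<close> \<open>v \<in> X\<close> pv(1)])
  have gD: "path_image g \<inter> drawing (M \<union> H) D pos \<gamma> = {pos p, pos v}"
  proof
    have "induced E X \<inter> D = {}"
    proof (rule ccontr)
      assume "induced E X \<inter> D \<noteq> {}"
      then obtain e where e: "e \<subseteq> X" "e \<in> D" "e \<in> E" by (auto simp: induced_def)
      then have "e \<subseteq> X \<inter> (M \<union> H)" using DMH(3) by blast
      then have "e \<subseteq> {p, v}" by (simp only: X(3))
      moreover have "card e = 2" using sg e(3) by (simp add: simple_graph_def)
      ultimately have "e = {p, v}" using pv(1) by (intro card_seteq) auto
      then show False using npv e by simp
    qed
    moreover have "\<Union>(induced E X) \<subseteq> X" by (auto simp: induced_def)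
    ultimately have "drawing X (induced E X) pos \<gamma> \<inter> drawing (M \<union> H) D pos \<gamma> = drawing {p, v} {} pos \<gamma>"
      using drawing_Int[OF emb X(1) DMH(1) induced_mono DMH(2) _ DMH(3)] X(3) by simp
    then show "path_image g \<inter> drawing (M \<union> H) D pos \<gamma> \<subseteq> {pos p, pos v}"
      using g(2) by (auto simp: drawing_def)
    have "pos p \<in> path_image g" "pos v \<in> path_image g"
      using g by (metis pathstart_in_path_image, metis pathfinish_in_path_image)
    then show "{pos p, pos v} \<subseteq> path_image g \<inter> drawing (M \<union> H) D pos \<gamma>"
      using M(2) H(2) by (auto simp: drawing_def)
  qed
  have "planar W ((`) \<rho> ` D)"
    unfolding W_def \<rho>_def
  proof (rule planar_contract[OF embD sgD _ _ pv(1) g(1) gD npv])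
    fix w assume "{p, w} \<in> D"
    then have "w \<in> M" using sides pv by blast
    then show "{v, w} \<notin> D" using sides pv \<open>M \<inter> H = {}\<close> by blast
  qed (use M H in auto)
  moreover have "simple_graph W ((`) \<rho> ` D)"
  proof -
    have "\<rho> ` e \<subseteq> W" "card (\<rho> ` e) = 2" if "e \<in> D" for e
    proof -
      have e: "e \<subseteq> M \<union> H" "card e = 2" using sgD that by (auto simp: simple_graph_def)
      show "\<rho> ` e \<subseteq> W" using e H pv by (auto simp: \<rho>_def W_def)
      have "inj_on \<rho> e" using sides[OF that] pv by (auto simp: inj_on_def \<rho>_def)
      then show "card (\<rho> ` e) = 2" using e by (simp add: card_image)
    qed
    then show ?thesis using sgD by (auto simp: simple_graph_def W_def)
  qed
  moreover have "card W < card V"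
    using finite_V DMH pv by (intro psubset_card_mono) (auto simp: W_def)
  ultimately have ch: "choosable 4 W ((`) \<rho> ` D)"
    using minimal_choosable[OF minimal] by blast
  obtain \<sigma> :: "nat \<Rightarrow> nat" where \<sigma>: "inj \<sigma>" "\<sigma> ` L p = L v" "\<sigma> ` good_colors M p \<inter> good_colors H v = {}"
    by (rule recoloring[of "L p" "L v" "good_colors M p" "good_colors H v"])
      (use lists pv small good_colors_subset M(2) H(2) in auto)
  \<comment> \<open>The merged vertex keeps the name \<open>v\<close> and the list
    \<open>L v\<close>, which is also the renamed list of \<open>p\<close>.\<close>
  define L' where "L' w = (if w \<in> M then \<sigma> ` L w else L w)" for w
  have "\<forall>w\<in>W. finite (L' w) \<and> card (L' w) = 4"
    using DMH lists \<sigma>(1) by (auto simp: L'_def W_def card_image inj_on_subset)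
  then obtain c where c: "\<forall>w\<in>W. c w \<in> L' w" "proper_coloring ((`) \<rho> ` D) c"
    using ch unfolding choosable_def by blast
  have cD: "c (\<rho> x) \<noteq> c (\<rho> y)" if "{x, y} \<in> D" for x y
  proof -
    have "{\<rho> x, \<rho> y} \<in> (`) \<rho> ` D" using that by (metis image_empty image_eqI image_insert)
    then show ?thesis using c(2) by (simp add: proper_coloring_def)
  qed
  have range: "c (\<rho> x) \<in> \<sigma> ` L x" if "x \<in> M" for x
  proof (cases "x = p")
    case True
    have "v \<in> W" using H pv by (auto simp: W_def)
    then have "c v \<in> L v" using c(1) pv by (auto simp: L'_def)
    then show ?thesis using True \<sigma>(2) by (simp add: \<rho>_def)
  next
    case False
    then have "x \<in> W" using that by (auto simp: W_def)
    then have "c x \<in> L' x" using c(1) by blast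
    then show ?thesis using that False by (simp add: \<rho>_def L'_def)
  qed
  \<comment> \<open>Undoing the renaming gives a list coloring of \<open>M\<close> in which the
    color of \<open>p\<close> is mapped by \<open>\<sigma>\<close> to \<open>c v\<close>, while
    \<open>c v\<close> is a good color of \<open>v\<close> in \<open>H\<close>: the two sets were
    made disjoint.\<close>
  define d where "d x = inv \<sigma> (c (\<rho> x))" for x
  have d: "\<sigma> (d x) = c (\<rho> x)" if "x \<in> M" for x
    using range[OF that] by (auto simp: d_def intro!: f_inv_into_f)
  have "list_coloring E L M d"
    unfolding list_coloring_def
  proof (intro conjI ballI impI)
    show "d x \<in> L x" if "x \<in> M" for x
      using range[OF that] \<sigma>(1) by (auto simp: d_def)
    fix x y assume xy: "x \<in> M" "y \<in> M" "{x, y} \<in> E"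
    then have "{x, y} \<in> D" by (auto simp: D_def induced_def)
    then show "d x \<noteq> d y" using cD d xy by metis
  qed
  then have "d p \<in> good_colors M p" by (auto simp: good_colors_def)
  moreover have "\<sigma> (d p) = c v" using d[OF M(2)] by (simp add: \<rho>_def)
  moreover have "list_coloring E L H c"
    unfolding list_coloring_def
  proof (intro conjI ballI impI)
    show "c x \<in> L x" if "x \<in> H" for x
    proof -
      have "x \<in> W" "x \<notin> M" using that pv \<open>M \<inter> H = {}\<close> by (auto simp: W_def)
      then show ?thesis using c(1) by (auto simp: L'_def)
    qed
    fix x y assume xy: "x \<in> H" "y \<in> H" "{x, y} \<in> E"
    then have "{x, y} \<in> D" by (auto simp: D_def induced_def)
    then have "c (\<rho> x) \<noteq> c (\<rho> y)" by (rule cD)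
    moreover have "x \<noteq> p" "y \<noteq> p" using xy pv(4) by auto
    ultimately show "c x \<noteq> c y" by (simp add: \<rho>_def)
  qed
  then have "c v \<in> good_colors H v" by (auto simp: good_colors_def)
  ultimately show False using \<sigma>(3) by (metis disjoint_iff image_eqI)
qed

end

section \<open>Connected vertex sets, components and complete graphs\<close>

lemma graph_connected_singleton: "graph_connected E {x}"
  unfolding graph_connected_def by blast

lemma graph_connected_insert:
  assumes S: "graph_connected E S" and x: "x \<in> S" "{x, y} \<in> E"
  shows "graph_connected E (insert y S)"
  unfolding graph_connected_def
proof (intro allI impI, rule ccontr)
  fix X assume X: "X \<subseteq> insert y S" "X \<noteq> {} \<and> X \<noteq> insert y S"
    and no: "\<not> (\<exists>a\<in>X. \<exists>b\<in>insert y S - X. {a, b} \<in> E)"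
  have yx: "{y, x} \<in> E" using x(2) by (simp add: insert_commute)
  have "X \<inter> S = {} \<or> X \<inter> S = S"
    using graph_connectedD[OF S, of "X \<inter> S"] no by blast
  then show False
  proof
    assume "X \<inter> S = {}"
    then have "X = {y}" "x \<notin> X" using X x by auto
    then show False using no x yx by blast
  next
    assume "X \<inter> S = S"
    then have "x \<in> X" "y \<notin> X" using X x by auto
    then show False using no x by blast
  qed
qed

lemma graph_component:
  assumes "finite Y" "x \<in> Y"
  obtains K where "K \<subseteq> Y" "x \<in> K" "graph_connected E K" "\<And>a b. a \<in> K \<Longrightarrow> b \<in> Y - K \<Longrightarrow> {a, b} \<notin> E"
proof -
  define P where "P K \<longleftrightarrow> K \<subseteq> Y \<and> x \<in> K \<and> graph_connected E K" for K
  have P1: "P {x}" using assms graph_connected_singleton by (auto simp: P_def)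
  have bd: "\<forall>K. P K \<longrightarrow> card K < Suc (card Y)"
    using assms(1) card_mono by (auto simp: P_def less_Suc_eq_le)
  \<comment> \<open>A connected subset of greatest cardinality through \<open>x\<close>; any edge
    leaving it inside \<open>Y\<close> would enlarge it.\<close>
  obtain K where PK: "P K" and max: "\<And>K'. P K' \<Longrightarrow> card K' \<le> card K"
    using ex_has_greatest_nat[of P "{x}" card "Suc (card Y)", OF P1 bd] by blast
  then have K: "K \<subseteq> Y" "x \<in> K" "graph_connected E K" by (auto simp: P_def)
  have "{a, b} \<notin> E" if ab: "a \<in> K" "b \<in> Y - K" for a b
  proof
    assume "{a, b} \<in> E"
    then have "graph_connected E (insert b K)" by (rule graph_connected_insert[OF K(3) ab(1)])
    then have "P (insert b K)" unfolding P_def using K(1,2) ab(2) by auto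
    then have "card (insert b K) \<le> card K" using max by blast
    moreover have "finite K" using K assms(1) finite_subset by blast
    ultimately show False using ab by simp
  qed
  then show thesis using that K by blast
qed

text \<open>Five mutually adjacent vertices cannot be colored from four common colors.\<close>

lemma complete_five_not_choosable:
  assumes "choosable 4 W D" "card W = 5" "\<And>x y. x \<in> W \<Longrightarrow> y \<in> W \<Longrightarrow> x \<noteq> y \<Longrightarrow> {x, y} \<in> D"
  shows False
proof -
  obtain c where c: "\<forall>v\<in>W. c v \<in> {..<4::nat}" "proper_coloring D c"
    using assms(1)[unfolded choosable_def, rule_format, of "\<lambda>_. {..<4}"] by auto
  have "inj_on c W"
    using c(2) assms(3) unfolding inj_on_def proper_coloring_def by metis
  moreover have "c ` W \<subseteq> {..<4}" using c(1) by auto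
  ultimately have "card W \<le> card {..<4::nat}" by (intro card_inj_on_le) auto
  then show False using assms(2) by simp
qed

section \<open>Reducible configurations hanging on a single vertex\<close>

context bad_lists
begin

text \<open>Suppose \<open>u\<close> had a further neighbor \<open>p\<close>. Whatever colorings of
  \<open>C - S\<close> and of the part outside \<open>C\<close> are combined, \<open>p\<close> and
  \<open>v\<close> must get different colors of \<open>L u\<close>. The two sets of good colors are
  then disjoint within a list of size 4, whereas identifying \<open>p\<close> with \<open>v\<close>
  along the path through \<open>u\<close> shows that they have at least five colors in
  total.\<close>

lemma pendant_nbrs:
  assumes C: "C \<subseteq> V" "v \<in> V" "v \<notin> C" "\<And>x y. x \<in> C \<Longrightarrow> {x, y} \<in> E \<Longrightarrow> y \<in> insert v C"
    and S: "S \<subseteq> C" "graph_connected E S" "\<And>u. u \<in> S \<Longrightarrow> card (nbrs E u) = 4" "nbrs E v \<inter> C \<subseteq> S"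
    and u: "u \<in> S" "u \<in> nbrs E v"
  shows "nbrs E u \<subseteq> insert v S"
proof (rule ccontr)
  assume "\<not> nbrs E u \<subseteq> insert v S"
  then obtain p where p: "p \<in> nbrs E u" "p \<notin> S" "p \<noteq> v" by blast
  have e: "{u, p} \<in> E" "{u, v} \<in> E" using p(1) u(2) by (auto simp: nbrs_def insert_commute)
  have "p \<in> C" using C(4)[of u p] S(1) u(1) e p by auto
  define M where "M = C - S"
  define H where "H = V - C"
  have "graph_connected E (insert v (insert p {u}))"
    by (intro graph_connected_insert[of _ _ u] graph_connected_singleton) (use e in auto)
  then have glue: "5 \<le> card (good_colors M p) + card (good_colors H v)"
    by (rule good_colors_glue[rotated 6])
      (use C(1-3) S(1) p \<open>p \<in> C\<close> u(1) in \<open>auto simp: M_def H_def\<close>)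
  have VS: "V - S = M \<union> H" using C(1) S(1) by (auto simp: M_def H_def)
  \<comment> \<open>The two colorings do not conflict, since all neighbors of \<open>v\<close> in
    \<open>C\<close> are in \<open>S\<close>. If \<open>p\<close> and \<open>v\<close> did not take
    two different colors of \<open>L u\<close>, then \<open>u\<close> would have a spare color and
    the coloring would extend over the connected set \<open>S\<close>.\<close>
  have both: "\<phi> p \<in> L u \<and> \<psi> v \<in> L u \<and> \<phi> p \<noteq> \<psi> v"
    if c: "list_coloring E L M \<phi>" "list_coloring E L H \<psi>" for \<phi> \<psi>
  proof (rule ccontr)
    assume bad: "\<not> (\<phi> p \<in> L u \<and> \<psi> v \<in> L u \<and> \<phi> p \<noteq> \<psi> v)"
    let ?c = "\<lambda>x. if x \<in> M then \<phi> x else \<psi> x"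
    have "list_coloring E L (M \<union> H) ?c"
    proof (rule list_coloring_Un[OF c])
      show "M \<inter> H = {}" by (auto simp: M_def H_def)
      fix x y assume xy: "x \<in> M" "y \<in> H" "{x, y} \<in> E"
      then have "y = v" using C(4)[of x y] by (auto simp: M_def H_def)
      then have "x \<in> nbrs E v \<inter> C" using xy by (auto simp: M_def nbrs_def insert_commute)
      then show "\<phi> x \<noteq> \<psi> y" using S(4) xy by (auto simp: M_def)
    qed
    then show False unfolding VS[symmetric]
    proof (rule extend_to_V[rotated])
      show "S \<subseteq> V" using C(1) S(1) by auto
      show "card (nbrs E x) \<le> 4" if "x \<in> S" for x using S(3)[OF that] by simp
      fix X assume X: "X \<subseteq> S" "X \<noteq> {}" "\<forall>x\<in>X. \<forall>y\<in>S - X. {x, y} \<notin> E"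
      then have "X = S" using graph_connectedD[OF S(2)] by blast
      have cp: "?c p = \<phi> p" "?c v = \<psi> v" using p \<open>p \<in> C\<close> C(3) by (auto simp: M_def)
      have q: "p \<in> nbrs E u - S" "v \<in> nbrs E u - S" using p e C(3) S(1) by (auto simp: nbrs_def)
      have "(\<exists>q \<in> nbrs E u - S. ?c q \<notin> L u) \<or> (\<exists>q \<in> nbrs E u - S. \<exists>q' \<in> nbrs E u - S. q \<noteq> q' \<and> ?c q = ?c q')"
        using bad q cp p(3) by metis
      then show "\<exists>x\<in>X. (\<exists>q \<in> nbrs E x - S. ?c q \<notin> L x) \<or>
          (\<exists>q \<in> nbrs E x - S. \<exists>q' \<in> nbrs E x - S. q \<noteq> q' \<and> ?c q = ?c q')"
        by (rule bexI[of _ u]) (use u(1) \<open>X = S\<close> in simp)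
    qed
  qed
  obtain \<phi>0 where \<phi>0: "list_coloring E L M \<phi>0"
    by (rule proper_subset_coloring[of M L]) (use C lists in \<open>auto simp: M_def\<close>)
  obtain \<psi>0 where \<psi>0: "list_coloring E L H \<psi>0"
    by (rule proper_subset_coloring[of H L]) (use C \<open>p \<in> C\<close> lists in \<open>auto simp: H_def\<close>)
  have sub: "good_colors M p \<union> good_colors H v \<subseteq> L u" "good_colors M p \<inter> good_colors H v = {}"
    using both \<phi>0 \<psi>0 unfolding good_colors_def by blast+
  have Lu: "finite (L u)" "card (L u) = 4" using lists[of u] C(1) S(1) u(1) by auto
  then have "card (good_colors M p) + card (good_colors H v) = card (good_colors M p \<union> good_colors H v)"
    using sub finite_subset[of _ "L u"] by (subst card_Un_disjoint) auto
  then show False using glue card_mono[OF Lu(1) sub(1)] Lu(2) by linarith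
qed

text \<open>With only one edge between \<open>C\<close> and the rest, any coloring of
  \<open>C\<close> and any coloring of the rest must agree at its two ends. Each side then has at
  most one good color, far from the five that are guaranteed.\<close>

lemma no_pendant_bridge:
  assumes C: "C \<subseteq> V" "v \<in> V" "v \<notin> C" "\<And>x y. x \<in> C \<Longrightarrow> {x, y} \<in> E \<Longrightarrow> y \<in> insert v C"
    and x: "nbrs E v \<inter> C = {x}"
  shows False
proof -
  have e: "{x, v} \<in> E" "x \<in> C" using x by (auto simp: nbrs_def insert_commute)
  define H where "H = V - C"
  have "graph_connected E (insert v {x})"
    by (intro graph_connected_insert[of _ _ x] graph_connected_singleton) (use e in auto)
  then have glue: "5 \<le> card (good_colors C x) + card (good_colors H v)"
    by (rule good_colors_glue[rotated 6]) (use C(1-3) e(2) in \<open>auto simp: H_def\<close>)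
  have eq: "\<phi> x = \<psi> v" if c: "list_coloring E L C \<phi>" "list_coloring E L H \<psi>" for \<phi> \<psi>
  proof (rule ccontr)
    assume ne: "\<phi> x \<noteq> \<psi> v"
    have "list_coloring E L (C \<union> H) (\<lambda>z. if z \<in> C then \<phi> z else \<psi> z)"
    proof (rule list_coloring_Un[OF c])
      show "C \<inter> H = {}" by (auto simp: H_def)
      fix a b assume ab: "a \<in> C" "b \<in> H" "{a, b} \<in> E"
      then have "b = v" using C(4)[of a b] by (auto simp: H_def)
      then have "a \<in> nbrs E v \<inter> C" using ab by (auto simp: nbrs_def insert_commute)
      then show "\<phi> a \<noteq> \<psi> b" using x ne \<open>b = v\<close> by auto
    qed
    moreover have "C \<union> H = V" using C(1) by (auto simp: H_def)
    ultimately show False using no_coloring by metis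
  qed
  obtain \<phi>0 where \<phi>0: "list_coloring E L C \<phi>0"
    by (rule proper_subset_coloring[of C L]) (use C lists in auto)
  obtain \<psi>0 where \<psi>0: "list_coloring E L H \<psi>0"
    by (rule proper_subset_coloring[of H L]) (use C e(2) lists in \<open>auto simp: H_def\<close>)
  have "good_colors C x \<subseteq> {\<psi>0 v}" "good_colors H v \<subseteq> {\<phi>0 x}"
    using eq \<phi>0 \<psi>0 unfolding good_colors_def by fastforce+
  then have "card (good_colors C x) \<le> 1" "card (good_colors H v) \<le> 1"
    using card_mono[of "{\<psi>0 v}"] card_mono[of "{\<phi>0 x}"] by fastforce+
  then show False using glue by linarith
qed

text \<open>A planar complete graph on five vertices would itself be a smaller
  counterexample.\<close>

lemma no_complete_five:
  assumes W: "W \<subset> V" "card W = 5" and D: "simple_graph W D" "planar W D"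
    and "\<And>x y. x \<in> W \<Longrightarrow> y \<in> W \<Longrightarrow> x \<noteq> y \<Longrightarrow> {x, y} \<in> D"
  shows False
proof -
  have "card W < card V" using W(1) finite_V by (rule psubset_card_mono[rotated])
  then show False
    using complete_five_not_choosable[OF minimal_choosable[OF minimal D] W(2) assms(5)] by blast
qed

text \<open>The six neighbors induce a connected cubic graph and all have the list of
  \<open>v\<close>. Two nonadjacent neighbors \<open>s\<close>, \<open>t\<close> receive the same
  color and \<open>v\<close> another one; their common neighbors then see a repeated color, and
  every closed-off part of the four remaining vertices contains such a neighbor.\<close>

lemma no_cubic_neighbourhood:
  assumes v: "v \<in> V" and S: "nbrs E v = S" "card S = 6" "graph_connected E S"
    and nb: "\<And>u. u \<in> S \<Longrightarrow> nbrs E u \<subseteq> insert v S" "\<And>u. u \<in> S \<Longrightarrow> card (nbrs E u) = 4"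
  shows False
proof -
  have SV: "S \<subseteq> V" "v \<notin> S" "finite S" using N(1,2,3)[of v] S(1) by auto
  define B where "B = V - insert v S"
  obtain \<phi> where \<phi>: "list_coloring E L B \<phi>"
    by (rule proper_subset_coloring[of B L]) (use v lists in \<open>auto simp: B_def\<close>)
  have noB: "{b, y} \<notin> E" if "b \<in> B" "y \<in> insert v S" for b y
    using that nb(1)[of y] S(1) by (auto simp: B_def nbrs_def insert_commute)
  have c3: "card (nbrs E u \<inter> S) = 3" if "u \<in> S" for u
  proof -
    have "v \<in> nbrs E u" using that S(1) nbrs_sym by fastforce
    then have "nbrs E u = insert v (nbrs E u \<inter> S)" using nb(1)[OF that] by auto
    then have "card (nbrs E u) = Suc (card (nbrs E u \<inter> S))"
      using SV by (metis IntD2 card_insert_disjoint finite_Int)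
    then show ?thesis using nb(2)[OF that] by simp
  qed
  \<comment> \<open>A color of \<open>L v\<close> missing from \<open>L u\<close>, given to
    \<open>v\<close>, would cost \<open>u\<close> nothing, and the coloring would extend over the
    connected set \<open>S\<close>. As the lists have equal size, inclusion gives equality.\<close>
  have LvLu: "L u = L v" if u: "u \<in> S" for u
  proof -
    have "c \<in> L u" if c: "c \<in> L v" for c
    proof (rule ccontr)
      assume cu: "c \<notin> L u"
      have "list_coloring E L (B \<union> {v}) (\<lambda>x. if x \<in> B then \<phi> x else c)"
        by (rule list_coloring_Un[OF \<phi>]) (use c noB no_loop in \<open>auto simp: list_coloring_def B_def\<close>)
      moreover have "B \<union> {v} = V - S" using v SV by (auto simp: B_def)
      ultimately have col: "list_coloring E L (V - S) (\<lambda>x. if x \<in> B then \<phi> x else c)" by metis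
      show False
      proof (rule extend_to_V[OF SV(1) col])
        show "card (nbrs E x) \<le> 4" if "x \<in> S" for x using nb(2)[OF that] by simp
        fix X assume X: "X \<subseteq> S" "X \<noteq> {}" "\<forall>x\<in>X. \<forall>y\<in>S - X. {x, y} \<notin> E"
        then have "X = S" using graph_connectedD[OF S(3)] by blast
        have "v \<in> nbrs E u - S" using u S(1) SV nbrs_sym by fastforce
        then show "\<exists>x\<in>X. (\<exists>q \<in> nbrs E x - S. (if q \<in> B then \<phi> q else c) \<notin> L x) \<or>
          (\<exists>q \<in> nbrs E x - S. \<exists>q' \<in> nbrs E x - S. q \<noteq> q' \<and> (if q \<in> B then \<phi> q else c) = (if q' \<in> B then \<phi> q' else c))"
          using cu u \<open>X = S\<close> by (intro bexI[of _ u] disjI1 bexI[of _ v]) (auto simp: B_def)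
      qed
    qed
    then have "L v \<subseteq> L u" by blast
    then show ?thesis using lists[OF v] lists[of u] u SV by (metis card_subset_eq subsetD)
  qed
  obtain c1 c2 where c12: "c1 \<in> L v" "c2 \<in> L v" "c1 \<noteq> c2"
  proof -
    have "\<not> card (L v) \<le> Suc 0" using lists[OF v] by simp
    then show thesis using that lists[OF v] by (metis card_le_Suc0_iff_eq)
  qed
  obtain s where s: "s \<in> S" using S(2) by fastforce
  \<comment> \<open>Only three of the five other vertices of \<open>S\<close> are adjacent to
    \<open>s\<close>.\<close>
  have "\<not> S \<subseteq> insert s (nbrs E s \<inter> S)"
  proof
    assume "S \<subseteq> insert s (nbrs E s \<inter> S)"
    then have "card S \<le> card (insert s (nbrs E s \<inter> S))" using SV by (intro card_mono) auto
    also have "\<dots> \<le> 4" using c3[OF s] SV by (simp add: card_insert_if)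
    finally show False using S(2) by simp
  qed
  then obtain t where t: "t \<in> S" "t \<noteq> s" "t \<notin> nbrs E s" by blast
  have st: "s \<notin> nbrs E t" using t nbrs_sym by fast
  define R where "R = S - {s, t}"
  have R: "finite R" "card R = 4" "R \<subseteq> S" "R \<subseteq> V" using s t S(2) SV by (auto simp: R_def card_Diff_subset)
  define \<theta> where "\<theta> x = (if x \<in> B then \<phi> x else if x = v then c1 else c2)" for x
  have VR: "V - R = B \<union> {v, s, t}" using v s t SV by (auto simp: R_def B_def)
  have vB: "v \<notin> B" "s \<notin> B" "t \<notin> B" using s t by (auto simp: B_def)
  have "list_coloring E L (B \<union> {v, s, t}) (\<lambda>x. if x \<in> B then \<phi> x else if x = v then c1 else c2)"
  proof (rule list_coloring_Un[OF \<phi>])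
    have sv: "s \<noteq> v" "t \<noteq> v" using s t SV by auto
    have sts: "{s, t} \<notin> E" "{t, s} \<notin> E" using t(3) st by (auto simp: nbrs_def)
    show "list_coloring E L {v, s, t} (\<lambda>x. if x = v then c1 else c2)"
      using c12 LvLu[OF s] LvLu[OF t(1)] sv t(2) no_loop sts by (auto simp: list_coloring_def)
    show "B \<inter> {v, s, t} = {}" using vB by auto
    show "\<phi> x \<noteq> (if y = v then c1 else c2)" if "x \<in> B" "y \<in> {v, s, t}" "{x, y} \<in> E" for x y
      using noB[of x y] that s t by auto
  qed
  then have col: "list_coloring E L (V - R) \<theta>" unfolding VR \<theta>_def .
  have sub: "nbrs E s \<inter> S \<subseteq> R" "nbrs E t \<inter> S \<subseteq> R" using t st N(1) by (auto simp: R_def)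
  define Q where "Q = nbrs E s \<inter> nbrs E t \<inter> S"
  \<comment> \<open>The three neighbors of \<open>s\<close> and the three neighbors of
    \<open>t\<close> in \<open>S\<close> all lie among the four vertices of
    \<open>R\<close>.\<close>
  have Q: "2 \<le> card Q" "Q \<subseteq> R"
  proof -
    have "card (nbrs E s \<inter> S \<union> nbrs E t \<inter> S) \<le> 4"
      using card_mono[OF R(1), of "nbrs E s \<inter> S \<union> nbrs E t \<inter> S"] sub R(2) by auto
    moreover have "card (nbrs E s \<inter> S) + card (nbrs E t \<inter> S) =
        card (nbrs E s \<inter> S \<union> nbrs E t \<inter> S) + card ((nbrs E s \<inter> S) \<inter> (nbrs E t \<inter> S))"
      using SV by (intro card_Un_Int) auto
    moreover have "(nbrs E s \<inter> S) \<inter> (nbrs E t \<inter> S) = Q" by (auto simp: Q_def)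
    ultimately show "2 \<le> card Q" using c3[OF s] c3[OF t(1)] by simp
    show "Q \<subseteq> R" using sub by (auto simp: Q_def)
  qed
  show False
  proof (rule extend_to_V[OF R(4) col])
    show "card (nbrs E x) \<le> 4" if "x \<in> R" for x using nb(2)[of x] R(3) that by auto
    fix X assume X: "X \<subseteq> R" "X \<noteq> {}" "\<forall>x\<in>X. \<forall>y\<in>R - X. {x, y} \<notin> E"
    \<comment> \<open>A vertex of \<open>X\<close> outside \<open>Q\<close> misses \<open>s\<close>
      or \<open>t\<close>, so at least two of its neighbors are in \<open>R\<close> and hence in
      \<open>X\<close>. If \<open>X\<close> avoided \<open>Q\<close>, there would be three vertices
      of \<open>X\<close> and two of \<open>Q\<close> in a set of four.\<close>
    have "X \<inter> Q \<noteq> {}"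
    proof
      assume XQ: "X \<inter> Q = {}"
      obtain x where x: "x \<in> X" using X(2) by blast
      then have xS: "x \<in> S" "x \<noteq> s" "x \<noteq> t" using X(1) by (auto simp: R_def)
      have "x \<notin> Q" using XQ x by auto
      then obtain r where r: "r \<in> {s, t}" "r \<notin> nbrs E x" using xS nbrs_sym by (fastforce simp: Q_def)
      have xX: "nbrs E x \<inter> R \<subseteq> X" using X(3) x by (auto simp: nbrs_def)
      have "nbrs E x \<inter> S \<subseteq> insert s (nbrs E x \<inter> R) \<or> nbrs E x \<inter> S \<subseteq> insert t (nbrs E x \<inter> R)"
        using r by (auto simp: R_def)
      then obtain r' where "nbrs E x \<inter> S \<subseteq> insert r' (nbrs E x \<inter> R)" by blast
      then have "card (nbrs E x \<inter> S) \<le> card (insert r' (nbrs E x \<inter> R))" using R by (intro card_mono) auto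
      then have "3 \<le> Suc (card (nbrs E x \<inter> R))"
        using c3[OF xS(1)] card_insert_le_m1[of "Suc (card (nbrs E x \<inter> R))" "nbrs E x \<inter> R" r'] by simp
      moreover have "card (insert x (nbrs E x \<inter> R)) \<le> card X"
        using X(1) R(1) x xX by (intro card_mono) (auto intro: finite_subset)
      moreover have "card (insert x (nbrs E x \<inter> R)) = Suc (card (nbrs E x \<inter> R))"
        using N(1) R(1) by (intro card_insert_disjoint) auto
      ultimately have "3 \<le> card X" by linarith
      moreover have "card (X \<union> Q) = card X + card Q"
        using X(1) Q(2) R(1) XQ by (intro card_Un_disjoint) (auto intro: finite_subset)
      moreover have "card (X \<union> Q) \<le> card R" using X(1) Q(2) R(1) by (intro card_mono) auto
      ultimately show False using Q(1) R(2) by linarith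
    qed
    then obtain x where x: "x \<in> X" "x \<in> Q" by blast
    have "s \<in> nbrs E x - R" "t \<in> nbrs E x - R" using x(2) by (auto simp: Q_def R_def nbrs_def insert_commute)
    moreover have "\<theta> s = \<theta> t" using vB s t(1) SV by (auto simp: \<theta>_def)
    ultimately show "\<exists>x\<in>X. (\<exists>q \<in> nbrs E x - R. \<theta> q \<notin> L x) \<or>
        (\<exists>q \<in> nbrs E x - R. \<exists>q' \<in> nbrs E x - R. q \<noteq> q' \<and> \<theta> q = \<theta> q')"
      using x(1) t(2) by metis
  qed
qed

end

section \<open>Vertices of degree six\<close>

text \<open>A nonempty union of components of what remains of \<open>S\<close> after removing
  \<open>z\<close>; the case that it is all of \<open>S - {z}\<close> is included.\<close>

definition end_piece :: "'a set set \<Rightarrow> 'a set \<Rightarrow> 'a \<Rightarrow> 'a set \<Rightarrow> bool" where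
  "end_piece E S z A \<longleftrightarrow> z \<in> S \<and> A \<subseteq> S - {z} \<and> A \<noteq> {} \<and> (\<forall>x\<in>A. \<forall>y\<in>S - A - {z}. {x, y} \<notin> E)"

text \<open>Take a smallest end piece within \<open>B\<close>. If one of its vertices
  \<open>t\<close> were a cut vertex of \<open>S\<close>, a side of \<open>t\<close> not containing
  \<open>z\<close> would be a smaller end piece, attached at \<open>t\<close>.\<close>

lemma end_piece_without_cut_vertices:
  assumes "finite S" "graph_connected E S" "end_piece E S z0 B"
  obtains z A where "A \<subseteq> B" "end_piece E S z A" "\<And>t. t \<in> A \<Longrightarrow> graph_connected E (S - {t})"
proof -
  define P where "P A \<longleftrightarrow> A \<subseteq> B \<and> (\<exists>z. end_piece E S z A)" for A
  have "P B" using assms(3) by (auto simp: P_def)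
  then obtain A where PA: "P A" and min: "\<And>A'. P A' \<Longrightarrow> card A \<le> card A'"
    using ex_has_least_nat[of P B card] by blast
  then have A: "A \<subseteq> B" by (simp add: P_def)
  obtain z where z: "end_piece E S z A" using PA by (auto simp: P_def)
  have "graph_connected E (S - {t})" if t: "t \<in> A" for t
    unfolding graph_connected_def
  proof (intro allI impI, rule ccontr)
    fix X assume X: "X \<subseteq> S - {t}" "X \<noteq> {} \<and> X \<noteq> S - {t}"
      and no: "\<not> (\<exists>x\<in>X. \<exists>y\<in>S - {t} - X. {x, y} \<in> E)"
    \<comment> \<open>The part of \<open>Y\<close> outside \<open>A\<close> has no edge leaving it
      in \<open>S\<close>, so it would be all of \<open>S\<close> if nonempty, though
      \<open>z\<close> is missing. Hence \<open>Y\<close> lies in \<open>A - {t}\<close>, against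
      minimality.\<close>
    have *: False if Y: "Y \<subseteq> S - {t}" "Y \<noteq> {}" "\<And>x y. x \<in> Y \<Longrightarrow> y \<in> S - {t} - Y \<Longrightarrow> {x, y} \<notin> E" "z \<notin> Y" for Y
    proof -
      have "Y - A = {}"
      proof (rule ccontr)
        assume ne: "Y - A \<noteq> {}"
        have "Y - A = S"
        proof (rule graph_connectedD[OF assms(2) _ ne])
          show "Y - A \<subseteq> S" using Y(1) by blast
          fix x y assume xy: "x \<in> Y - A" "y \<in> S - (Y - A)"
          show "{x, y} \<notin> E"
          proof (cases "y \<in> A")
            case True
            then have "{y, x} \<notin> E" using z xy Y(1,4) unfolding end_piece_def by blast
            then show ?thesis by (simp add: insert_commute)
          next
            case False
            then have "y \<in> S - {t} - Y" using xy t by blast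
            then show ?thesis using Y(3) xy by blast
          qed
        qed
        then show False using z Y(4) unfolding end_piece_def by blast
      qed
      then have "Y \<subseteq> A - {t}" using Y(1) by blast
      moreover have "end_piece E S t Y"
        using Y z t unfolding end_piece_def by blast
      ultimately have "P Y" using A by (auto simp: P_def)
      then have "card A \<le> card Y" by (rule min)
      moreover have "finite A" using z assms(1) finite_subset unfolding end_piece_def by blast
      then have "card Y < card A" using \<open>Y \<subseteq> A - {t}\<close> t by (intro psubset_card_mono) blast+
      ultimately show False by simp
    qed
    show False
    proof (cases "z \<in> X")
      case False
      then show False using *[of X] X no by blast
    next
      case True
      have "{x, y} \<notin> E" if "x \<in> S - {t} - X" "y \<in> S - {t} - (S - {t} - X)" for x y
        using no that X(1) by (metis DiffD1 DiffD2 DiffI insert_commute)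
      then show False using *[of "S - {t} - X"] X True by blast
    qed
  qed
  then show thesis using that A z by blast
qed

context bad_lists
begin

text \<open>Let \<open>S\<close> be a smallest connected subset of \<open>K\<close> that contains
  the set \<open>A0\<close> of neighbors of \<open>v\<close> in \<open>C\<close>. Every vertex of
  \<open>A0\<close> has its other three neighbors in \<open>S\<close>. If \<open>S = A0\<close>,
  then \<open>S\<close> has four, five or six vertices, and the configuration is a complete graph on
  five vertices, a bridge on the other side of \<open>v\<close>, or a cubic neighborhood. Otherwise
  \<open>S\<close> has a cut vertex, and an end piece yields a complete graph on five vertices,
  possibly with one edge subdivided.\<close>

lemma no_pendant_deg4_attachment:
  assumes v: "v \<in> V" "card (nbrs E v) = 6"
    and C: "C \<subseteq> V" "v \<notin> C" "\<And>x y. x \<in> C \<Longrightarrow> {x, y} \<in> E \<Longrightarrow> y \<in> insert v C"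
    and K: "K \<subseteq> C" "graph_connected E K" "\<And>u. u \<in> K \<Longrightarrow> card (nbrs E u) = 4"
      "nbrs E v \<inter> C \<subseteq> K" "nbrs E v \<inter> C \<noteq> {}"
  shows False
proof -
  define A0 where "A0 = nbrs E v \<inter> C"
  define P where "P S \<longleftrightarrow> S \<subseteq> K \<and> graph_connected E S \<and> A0 \<subseteq> S" for S
  have "P K" using K(2,4) by (simp add: A0_def P_def)
  then obtain S where PS: "P S" and min: "\<And>S'. P S' \<Longrightarrow> card S \<le> card S'"
    using ex_has_least_nat[of P K card] by blast
  then have S: "S \<subseteq> K" "graph_connected E S" "A0 \<subseteq> S" by (auto simp: P_def)
  have S4: "card (nbrs E u) = 4" if "u \<in> S" for u using K(3) S that by blast
  have SC: "S \<subseteq> C" "S \<subseteq> V" "v \<notin> S" "finite S" "A0 \<subseteq> S" "graph_connected E S"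
  proof -
    show SC: "S \<subseteq> C" using S(1) K(1) by (rule order_trans)
    then show SV: "S \<subseteq> V" using C(1) by (rule order_trans)
    show "v \<notin> S" using SC C(2) by auto
    show "finite S" using SV finite_V by (rule finite_subset)
  qed (use S in auto)
  have A0: "finite A0" "card A0 \<le> 6" "A0 \<noteq> {}"
    using N(3)[of v] card_mono[OF N(3), of A0 v] v(2) K(5) by (auto simp: A0_def)
  have nbA: "nbrs E u \<subseteq> insert v S" "v \<in> nbrs E u" if u: "u \<in> A0" for u
  proof -
    have "u \<in> nbrs E v" "u \<in> S" using u SC(5) by (auto simp: A0_def)
    then show "nbrs E u \<subseteq> insert v S"
      by (intro pendant_nbrs[OF C(1) v(1) C(2,3) SC(1,6) S4]) (use SC(5) in \<open>auto simp: A0_def\<close>)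
    show "v \<in> nbrs E u" using \<open>u \<in> nbrs E v\<close> by (simp add: nbrs_def insert_commute)
  qed
  have c3: "card (nbrs E u \<inter> S) = 3" if u: "u \<in> A0" for u
  proof -
    have "nbrs E u = insert v (nbrs E u \<inter> S)" using nbA[OF u] by auto
    then have "card (nbrs E u) = Suc (card (nbrs E u \<inter> S))"
      using SC(3,4) by (metis IntD2 card_insert_disjoint finite_Int)
    then show ?thesis using S4[of u] u SC(5) by auto
  qed
  \<comment> \<open>A vertex outside \<open>A0\<close> whose removal keeps \<open>S\<close>
    connected could be omitted from the smallest set.\<close>
  have noncut: "t \<in> A0" if t: "t \<in> S" "graph_connected E (S - {t})" for t
  proof (rule ccontr)
    assume "t \<notin> A0"
    then have "P (S - {t})" unfolding P_def using S t by blast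
    then have "card S \<le> card (S - {t})" by (rule min)
    then show False using t(1) SC(4) by (meson card_Diff1_less leD)
  qed
  have "card V \<ge> 7"
  proof -
    have "card (insert v (nbrs E v)) \<le> card V" using N(2) v(1) finite_V by (intro card_mono) auto
    then show ?thesis using N(1,3) v(2) by simp
  qed
  then have big: "W \<noteq> V" if "card W = 5" for W using that by auto
  show False
  proof (cases "S = A0")
    case True
    have four: "4 \<le> card S"
    proof -
      obtain u where u: "u \<in> A0" using A0(3) by blast
      have "card (insert u (nbrs E u \<inter> S)) \<le> card S" using True u SC(4) by (intro card_mono) auto
      then show ?thesis using c3[OF u] N(1) SC(4) by simp
    qed
    then have "card S = 4 \<or> card S = 5 \<or> card S = 6" using A0(2) True by auto
    then consider "card S = 4" | "card S = 5" | "card S = 6" by blast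
    then show False
    proof cases
      case 1
      \<comment> \<open>Four vertices with three neighbors each among themselves are mutually
        adjacent, and \<open>v\<close> is adjacent to all of them.\<close>
      have full: "nbrs E u \<inter> S = S - {u}" if "u \<in> S" for u
        using c3[of u] that True 1 SC(4) N(1) by (intro card_seteq) auto
      have card5: "card (insert v S) = 5" using 1 SC(3,4) by simp
      have sub: "insert v S \<subseteq> V" "\<Union>(induced E (insert v S)) \<subseteq> insert v S"
        using SC(2) v(1) by (auto simp: induced_def)
      show False
      proof (rule no_complete_five[OF _ card5])
        show "insert v S \<subset> V" using sub(1) big[OF card5] by auto
        show "simple_graph (insert v S) (induced E (insert v S))"
          using simple_graph_subset[OF sg sub(1) induced_mono sub(2)] .
        show "planar (insert v S) (induced E (insert v S))"
          using planar_subset[OF planar sub(1) induced_mono sub(2)] .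
        fix x y assume xy: "x \<in> insert v S" "y \<in> insert v S" "x \<noteq> y"
        have "y \<in> nbrs E x"
        proof (cases "x = v \<or> y = v")
          case True
          then show ?thesis using nbA(2)[of x] nbA(2)[of y] xy \<open>S = A0\<close> nbrs_sym[of y E x] by auto
        next
          case False
          then show ?thesis using full[of x] xy by auto
        qed
        then show "{x, y} \<in> induced E (insert v S)" using xy by (simp add: induced_def nbrs_def)
      qed
    next
      case 2
      \<comment> \<open>Five of the six neighbors are in \<open>C\<close>, so the remaining edge at
        \<open>v\<close> is a bridge to \<open>V - insert v C\<close>.\<close>
      have "card (nbrs E v - A0) = 1"
        using v(2) 2 True A0(1) by (subst card_Diff_subset) (auto simp: A0_def)
      then obtain x where x: "nbrs E v - A0 = {x}" by (auto simp: card_1_singleton_iff)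
      show False
      proof (rule no_pendant_bridge[of "V - insert v C" v x])
        show "nbrs E v \<inter> (V - insert v C) = {x}"
          using x N(1,2) by (auto simp: A0_def)
        fix a b assume ab: "a \<in> V - insert v C" "{a, b} \<in> E"
        then have "{b, a} \<in> E" "b \<in> V" using N(2)[of a] by (auto simp: nbrs_def insert_commute)
        then show "b \<in> insert v (V - insert v C)" using C(3)[of b a] ab(1) by auto
      qed (use v in auto)
    next
      case 3
      have "nbrs E v = S"
        using 3 v(2) True N(3) card_subset_eq[of "nbrs E v" A0] by (auto simp: A0_def)
      then show False
        using no_cubic_neighbourhood[OF v(1) _ 3 SC(6)] nbA True S4 by blast
    qed
  next
    case False
    \<comment> \<open>Such a \<open>w\<close> is a cut vertex of \<open>S\<close>; on both of its
      sides an end piece free of cut vertices is chosen.\<close>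
    then obtain w where w: "w \<in> S" "w \<notin> A0" using SC(5) by blast
    then obtain X where X: "X \<subseteq> S - {w}" "X \<noteq> {}" "X \<noteq> S - {w}"
      and no: "\<And>x y. x \<in> X \<Longrightarrow> y \<in> S - {w} - X \<Longrightarrow> {x, y} \<notin> E"
      using noncut[OF w(1)] unfolding graph_connected_def by blast
    define Y where "Y = S - {w} - X"
    have noY: "{y, x} \<notin> E" if "x \<in> X" "y \<in> Y" for x y
      using no[of x y] that by (simp add: Y_def insert_commute)
    have eX: "end_piece E S w X" using X w no unfolding end_piece_def by blast
    have eY: "end_piece E S w Y" using X w noY unfolding end_piece_def Y_def by blast
    obtain z A where A: "A \<subseteq> X" "end_piece E S z A" "\<And>t. t \<in> A \<Longrightarrow> graph_connected E (S - {t})"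
      by (rule end_piece_without_cut_vertices[OF SC(4,6) eX]) blast
    obtain z' A' where A': "A' \<subseteq> Y" "end_piece E S z' A'" "\<And>t. t \<in> A' \<Longrightarrow> graph_connected E (S - {t})"
      by (rule end_piece_without_cut_vertices[OF SC(4,6) eY]) blast
    \<comment> \<open>Free of cut vertices, the piece consists of neighbors of \<open>v\<close>. One
      of its vertices has three neighbors in \<open>S\<close>, all of them in the piece or equal to
      \<open>y\<close>, which forces at least three vertices.\<close>
    have piece: "B \<subseteq> A0 \<and> finite B \<and> 3 \<le> card B \<and> (\<forall>t\<in>B. nbrs E t \<inter> S \<subseteq> insert y B - {t})"
      if B: "end_piece E S y B" "\<And>t. t \<in> B \<Longrightarrow> graph_connected E (S - {t})" for B y
    proof -
      have BS: "B \<subseteq> S" "y \<in> S" "y \<notin> B" "B \<noteq> {}" using B(1) by (auto simp: end_piece_def)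
      have "finite B" using BS(1) SC(4) by (rule finite_subset)
      note BS = BS this
      then have BA: "B \<subseteq> A0" using B(2) noncut by blast
      have nb: "nbrs E t \<inter> S \<subseteq> insert y B - {t}" if "t \<in> B" for t
        using B(1) that N(1)[of t] unfolding end_piece_def nbrs_def by blast
      obtain t where t: "t \<in> B" using BS(4) by blast
      have "3 \<le> card (insert y B - {t})" using card_mono[OF _ nb[OF t]] c3[of t] t BA BS(5) by auto
      then have "3 \<le> card B" using t BS(3,5) by (simp add: card_Diff_singleton_if)
      then show ?thesis using BA BS nb by blast
    qed
    have pA: "A \<subseteq> A0" "finite A" "3 \<le> card A" and nbz: "\<And>t. t \<in> A \<Longrightarrow> nbrs E t \<inter> S \<subseteq> insert z A - {t}"
      using piece[OF A(2,3)] by blast+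
    have pA': "A' \<subseteq> A0" "finite A'" "3 \<le> card A'" using piece[OF A'(2,3)] by blast+
    have disj: "A \<inter> A' = {}" using A(1) A'(1) by (auto simp: Y_def)
    \<comment> \<open>Two disjoint pieces with at least three neighbors of \<open>v\<close> each
      exhaust the six; so \<open>A\<close> has exactly three vertices, mutually adjacent and all
      adjacent to \<open>z\<close>.\<close>
    have "card (A \<union> A') \<le> 6" using card_mono[OF A0(1), of "A \<union> A'"] pA(1) pA'(1) A0(2) by auto
    then have cA: "card A = 3" using card_Un_disjoint[OF pA(2) pA'(2) disj] pA(3) pA'(3) by linarith
    have z: "z \<in> S" "z \<notin> A" "A \<subseteq> S" "z \<noteq> v" using A(2) SC(3) unfolding end_piece_def by blast+
    have full: "nbrs E t \<inter> S = insert z A - {t}" if "t \<in> A" for t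
      using nbz[OF that] c3[of t] that pA(1,2) cA z(2) by (intro card_seteq) (auto simp: card_Diff_singleton_if)
    \<comment> \<open>Five vertices that are mutually adjacent except perhaps for \<open>z\<close>
      and \<open>v\<close>.\<close>
    define W where "W = insert v (insert z A)"
    have "v \<notin> A" using z(3) SC(3) by blast
    then have W: "card W = 5" "W \<subseteq> V" using cA pA(2) z SC(2,3) v(1) by (auto simp: W_def)
    have WV: "W \<subset> V" using W big by blast
    have Wsub: "\<Union>(induced E W) \<subseteq> W" by (auto simp: induced_def)
    have sgW: "simple_graph W (induced E W)" by (rule simple_graph_subset[OF sg W(2) induced_mono Wsub])
    have embW: "plane_embedding W (induced E W) pos \<gamma>" by (rule plane_embedding_subset[OF emb W(2) induced_mono Wsub])
    have adj: "{x, y} \<in> induced E W" if xy: "x \<in> W" "y \<in> W" "x \<noteq> y" "{x, y} \<noteq> {z, v}" for x y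
    proof -
      have *: "{a, b} \<in> E" if "a \<in> A" "b \<in> W" "b \<noteq> a" for a b
      proof (cases "b = v")
        case True then show ?thesis using nbA(2)[of a] that(1) pA(1) by (auto simp: nbrs_def)
      next
        case False then show ?thesis using full[OF that(1)] that by (auto simp: W_def nbrs_def)
      qed
      have "x \<in> A \<or> y \<in> A" using xy by (auto simp: W_def insert_commute)
      then have "{x, y} \<in> E" using *[of x y] *[of y x] xy by (auto simp: insert_commute)
      then show ?thesis using xy by (simp add: induced_def)
    qed
    show False
    proof (cases "{z, v} \<in> E")
      case True
      then have "{z, v} \<in> induced E W" by (simp add: induced_def W_def)
      then show False using no_complete_five[OF WV W(1) sgW] embW adj unfolding planar_def by metis
    next
      case False
      \<comment> \<open>The missing edge is drawn along the rest of \<open>S\<close>. As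
        \<open>A\<close> is attached to it only at \<open>z\<close>, the set \<open>S - A\<close>
        stays connected; it contains \<open>z\<close> and, through the other piece
        \<open>A'\<close>, leads to \<open>v\<close>, without meeting \<open>W\<close>
        elsewhere.\<close>
      define X' where "X' = insert v (S - A)"
      have con: "graph_connected E (S - A)"
        unfolding graph_connected_def
      proof (intro allI impI, rule ccontr)
        fix U assume U: "U \<subseteq> S - A" "U \<noteq> {} \<and> U \<noteq> S - A"
          and noU: "\<not> (\<exists>x\<in>U. \<exists>y\<in>S - A - U. {x, y} \<in> E)"
        have *: False if Z: "Z \<subseteq> S - A" "Z \<noteq> {}" "\<And>x y. x \<in> Z \<Longrightarrow> y \<in> S - A - Z \<Longrightarrow> {x, y} \<notin> E" "z \<notin> Z" for Z
        proof -
          have "Z = S"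
          proof (rule graph_connectedD[OF SC(6) _ Z(2)])
            fix x y assume xy: "x \<in> Z" "y \<in> S - Z"
            show "{x, y} \<notin> E"
            proof (cases "y \<in> A")
              case True
              have "x \<in> S" "x \<notin> insert z A" using xy(1) Z(1,4) by auto
              then have "x \<notin> nbrs E y" using full[OF True] by auto
              then show ?thesis by (auto simp: nbrs_def insert_commute)
            next
              case False
              then show ?thesis using Z(3) xy by blast
            qed
          qed (use Z in blast)
          then show False using Z(4) z by blast
        qed
        show False
        proof (cases "z \<in> U")
          case False
          then show False using *[of U] U noU by blast
        next
          case True
          have "{x, y} \<notin> E" if "x \<in> S - A - U" "y \<in> S - A - (S - A - U)" for x y
            using noU that U(1) by (metis DiffD1 DiffD2 DiffI insert_commute)
          then show False using *[of "S - A - U"] U True by blast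
        qed
      qed
      obtain a' where a': "a' \<in> A'" using pA'(3) by fastforce
      then have "a' \<in> S - A" "{a', v} \<in> E" using disj pA'(1) SC(5) nbA(2)[of a'] by (auto simp: nbrs_def)
      then have conX: "graph_connected E X'" unfolding X'_def by (intro graph_connected_insert[OF con])
      have X'V: "X' \<subseteq> V" "z \<in> X'" "v \<in> X'" using SC(2) v(1) z by (auto simp: X'_def)
      obtain g where g: "arc g" "path_image g \<subseteq> drawing X' (induced E X') pos \<gamma>" "pathstart g = pos z" "pathfinish g = pos v"
        by (rule arc_in_drawing[OF emb sg conX X'V z(4)])
      have X'W: "X' \<inter> W = {z, v}" using z SC(3) pA(1) SC(5) by (auto simp: X'_def W_def)
      have "path_image g \<inter> drawing W (induced E W) pos \<gamma> = {pos z, pos v}"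
      proof
        have "induced E X' \<inter> induced E W = {}"
        proof (rule ccontr)
          assume "induced E X' \<inter> induced E W \<noteq> {}"
          then obtain e where e: "e \<subseteq> X' \<inter> W" "e \<in> E" by (auto simp: induced_def)
          moreover have "card e = 2" using sg e(2) by (simp add: simple_graph_def)
          ultimately have "e = {z, v}" using z(4) unfolding X'W by (intro card_seteq) auto
          then show False using e(2) \<open>{z, v} \<notin> E\<close> by simp
        qed
        moreover have "\<Union>(induced E X') \<subseteq> X'" by (auto simp: induced_def)
        ultimately have "drawing X' (induced E X') pos \<gamma> \<inter> drawing W (induced E W) pos \<gamma> = drawing {z, v} {} pos \<gamma>"
          using drawing_Int[OF emb X'V(1) W(2) induced_mono induced_mono _ Wsub] X'W by simp
        then show "path_image g \<inter> drawing W (induced E W) pos \<gamma> \<subseteq> {pos z, pos v}"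
          using g(2) by (auto simp: drawing_def)
        have "pos z \<in> path_image g" "pos v \<in> path_image g"
          using g by (metis pathstart_in_path_image, metis pathfinish_in_path_image)
        then show "{pos z, pos v} \<subseteq> path_image g \<inter> drawing W (induced E W) pos \<gamma>"
          by (auto simp: drawing_def W_def)
      qed
      moreover have "{z, v} \<notin> induced E W" using False by (simp add: induced_def)
      ultimately have "plane_embedding W (insert {z, v} (induced E W)) pos (\<gamma>({z, v} := g))"
        using plane_embedding_add_edge[OF embW sgW _ _ _ g(1,3,4)] by (simp add: W_def)
      then have pl: "planar W (insert {z, v} (induced E W))" unfolding planar_def by blast
      have "simple_graph W (insert {z, v} (induced E W))"
        using sgW z(4) by (auto simp: simple_graph_def W_def)
      then show False
        using no_complete_five[OF WV W(1) _ pl] adj by (metis insertCI)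
    qed
  qed
qed

text \<open>The drawings \<open>P\<close> and \<open>Q\<close> meet only in the point of
  \<open>v\<close>, and the remaining edges \<open>T\<close> run between them. Each edge of
  \<open>T\<close> has an end of degree at least 5 other than \<open>v\<close>, so a face with a
  whole such edge on its frontier has the required vertex.\<close>

lemma two_faces_with_large_vertices:
  assumes v: "v \<in> V" "card (nbrs E v) = 6"
  shows "\<exists>F\<^sub>1 \<in> faces V E pos \<gamma>. \<exists>F\<^sub>2 \<in> faces V E pos \<gamma>. F\<^sub>1 \<noteq> F\<^sub>2 \<and>
    (\<forall>F \<in> {F\<^sub>1, F\<^sub>2}. face_incident pos F v \<and> (\<exists>u \<in> V. u \<noteq> v \<and> face_incident pos F u \<and> 5 \<le> card (nbrs E u)))"
proof -
  obtain x where x: "x \<in> nbrs E v" using v(2) by fastforce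
  have xV: "x \<in> V" "x \<noteq> v" "{v, x} \<in> E" "{x, v} \<in> E"
    using x N(1,2)[of v] by (auto simp: nbrs_def insert_commute)
  \<comment> \<open>If \<open>x\<close> has degree 4, this is its component among the vertices of
    degree 4, and every edge leaving it ends in a vertex of larger degree; otherwise
    \<open>x\<close> itself is the large end.\<close>
  obtain K0 where K0: "K0 \<subseteq> V" "x \<in> K0" "v \<notin> K0" "graph_connected E K0"
    and kind: "(\<forall>u\<in>K0. card (nbrs E u) = 4) \<or> K0 = {x}"
    and large: "\<And>a b. a \<in> K0 \<Longrightarrow> b \<in> V - K0 \<Longrightarrow> {a, b} \<in> E \<Longrightarrow> 5 \<le> card (nbrs E a) \<or> 5 \<le> card (nbrs E b)"
  proof (cases "card (nbrs E x) = 4")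
    case True
    define D where "D = {u \<in> V. card (nbrs E u) = 4}"
    have D: "finite D" "x \<in> D" "v \<notin> D" using finite_V xV True v(2) by (auto simp: D_def)
    obtain K where K: "K \<subseteq> D" "x \<in> K" "graph_connected E K" "\<And>a b. a \<in> K \<Longrightarrow> b \<in> D - K \<Longrightarrow> {a, b} \<notin> E"
      by (rule graph_component[OF D(1,2)]) blast
    show thesis
    proof (rule that[of K])
      fix a b assume ab: "a \<in> K" "b \<in> V - K" "{a, b} \<in> E"
      then have "b \<notin> D" using K(4) by blast
      then show "5 \<le> card (nbrs E a) \<or> 5 \<le> card (nbrs E b)"
        using ab(2) min_degree[of b] by (auto simp: D_def)
    qed (use K D in \<open>auto simp: D_def\<close>)
  next
    case False
    then have "5 \<le> card (nbrs E x)" using min_degree[OF xV(1)] by linarith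
    then show thesis using xV graph_connected_singleton by (intro that[of "{x}"]) auto
  qed
  obtain R where R: "R \<subseteq> V - K0" "v \<in> R" "graph_connected E R"
    and Rmax: "\<And>a b. a \<in> R \<Longrightarrow> b \<in> V - K0 - R \<Longrightarrow> {a, b} \<notin> E"
    by (rule graph_component[of "V - K0" v]) (use finite_V v(1) K0(3) in auto)
  \<comment> \<open>Besides \<open>K0\<close> this contains the components of the rest that do not
    contain \<open>v\<close>; edges from \<open>K\<close> to \<open>R\<close> still start in
    \<open>K0\<close>, as \<open>cross\<close> shows.\<close>
  define K where "K = V - R"
  have KR: "K \<subseteq> V" "R \<subseteq> V" "K0 \<subseteq> K" "v \<notin> K" "K \<inter> R = {}" "K \<union> R = V"
    using R K0 by (auto simp: K_def)
  have cross: "a \<in> K0" if "a \<in> K" "b \<in> R" "{a, b} \<in> E" for a b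
  proof (rule ccontr)
    assume "a \<notin> K0"
    then have "{b, a} \<notin> E" using Rmax[of b a] that by (auto simp: K_def)
    then show False using that(3) by (simp add: insert_commute)
  qed
  define T where "T = {e \<in> E. \<exists>a\<in>K. \<exists>b\<in>R - {v}. e = {a, b}}"
  \<comment> \<open>Otherwise \<open>K\<close> would hang on \<open>v\<close> alone, attached
    through connected vertices of degree 4 or by the single edge to \<open>x\<close>, and both are
    reducible.\<close>
  have "T \<noteq> {}"
  proof
    assume T: "T = {}"
    have closed: "b \<in> insert v K" if ab: "a \<in> K" "{a, b} \<in> E" for a b
    proof (rule ccontr)
      assume "b \<notin> insert v K"
      moreover have "b \<in> V" using ab N(2)[of a] by (auto simp: nbrs_def)
      ultimately have "b \<in> R - {v}" by (auto simp: K_def)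
      then have "{a, b} \<in> T" using ab by (auto simp: T_def)
      then show False using T by simp
    qed
    have att: "nbrs E v \<inter> K \<subseteq> K0"
    proof
      fix a assume "a \<in> nbrs E v \<inter> K"
      then show "a \<in> K0" using cross[of a v] R(2) by (auto simp: nbrs_def insert_commute)
    qed
    have xK: "x \<in> nbrs E v \<inter> K" using x K0(2) KR(3) by auto
    from kind show False
    proof
      assume deg4: "\<forall>u\<in>K0. card (nbrs E u) = 4"
      show False
      proof (rule no_pendant_deg4_attachment[OF v KR(1,4) _ KR(3) K0(4) _ att])
        show "\<And>a b. a \<in> K \<Longrightarrow> {a, b} \<in> E \<Longrightarrow> b \<in> insert v K" by (rule closed)
      qed (use deg4 xK in auto)
    next
      assume "K0 = {x}"
      then have single: "nbrs E v \<inter> K = {x}" using att xK by auto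
      show False
      proof (rule no_pendant_bridge[OF KR(1) v(1) KR(4)])
        show "\<And>a b. a \<in> K \<Longrightarrow> {a, b} \<in> E \<Longrightarrow> b \<in> insert v K" by (rule closed)
      qed (rule single)
    qed
  qed
  have eE: "e \<subseteq> V" "e \<in> E" if "e \<in> T" for e using that sg by (auto simp: T_def simple_graph_def)
  define P where "P = drawing (insert v K) (induced E (insert v K)) pos \<gamma>"
  define Q where "Q = drawing R (induced E R) pos \<gamma>"
  \<comment> \<open>Edges of \<open>T\<close> are oriented so that they start in \<open>K\<close>
    and end in \<open>R\<close>.\<close>
  define h where "h e = (if pathstart (\<gamma> e) \<in> pos ` K then \<gamma> e else reversepath (\<gamma> e))" for e
  note D = plane_embeddingD[OF emb]
  have ivK: "insert v K \<subseteq> V" using KR(1) v(1) by auto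
  have sub: "\<Union>(induced E (insert v K)) \<subseteq> insert v K" "\<Union>(induced E R) \<subseteq> R" by (auto simp: induced_def)
  have fin: "finite (insert v K)" "finite R" "finite E"
    using ivK KR(2) finite_V simple_graph_finite_edges[OF sg] finite_subset by auto
  have conP: "graph_connected E (insert v K)"
    unfolding graph_connected_def
  proof (intro allI impI, rule ccontr)
    fix X assume X: "X \<subseteq> insert v K" "X \<noteq> {} \<and> X \<noteq> insert v K"
      and no: "\<not> (\<exists>a\<in>X. \<exists>b\<in>insert v K - X. {a, b} \<in> E)"
    have con0: "graph_connected E (insert v K0)" by (rule graph_connected_insert[OF K0(4,2) xV(4)])
    have "X \<inter> insert v K0 = {} \<or> X \<inter> insert v K0 = insert v K0"
      using graph_connectedD[OF con0, of "X \<inter> insert v K0"] no KR(3) by blast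
    \<comment> \<open>A part of \<open>K - K0\<close> has no edge to \<open>R\<close>, so if it is
      also closed off within \<open>insert v K\<close>, it is closed off in the whole graph, which
      is connected.\<close>
    moreover have *: False if Y: "Y \<subseteq> K - K0" "Y \<noteq> {}" "\<And>a b. a \<in> Y \<Longrightarrow> b \<in> insert v K - Y \<Longrightarrow> {a, b} \<notin> E" for Y
    proof -
      have "Y = V"
      proof (rule graph_connectedD[OF connected_V _ Y(2)])
        fix a b assume ab: "a \<in> Y" "b \<in> V - Y"
        show "{a, b} \<notin> E"
        proof (cases "b \<in> R")
          case True then show ?thesis using cross[of a b] ab Y(1) by blast
        next
          case False then show ?thesis using Y(3) ab by (auto simp: K_def)
        qed
      qed (use Y(1) KR(1) in blast)
      then show False using Y(1) v(1) KR(4) by blast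
    qed
    ultimately show False
    proof (elim disjE)
      assume "X \<inter> insert v K0 = {}"
      then show False using *[of X] X no by blast
    next
      assume i: "X \<inter> insert v K0 = insert v K0"
      have "{a, b} \<notin> E" if "a \<in> insert v K - X" "b \<in> insert v K - (insert v K - X)" for a b
        using no that X(1) by (metis DiffD1 DiffD2 DiffI insert_commute)
      then show False using *[of "insert v K - X"] X i by blast
    qed
  qed
  have PQ: "compact P" "compact Q" "path_connected P" "path_connected Q"
    unfolding P_def Q_def
    using compact_drawing[OF emb fin(1) _ induced_mono] compact_drawing[OF emb fin(2) _ induced_mono]
      finite_subset[OF induced_mono fin(3)] path_connected_drawing[OF emb sg conP] path_connected_drawing[OF emb sg R(3)]
    by auto
  have PQv: "P \<inter> Q = {pos v}"
  proof -
    have i: "insert v K \<inter> R = {v}" using KR(5) R(2) by auto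
    have "induced E (insert v K) \<inter> induced E R = {}"
    proof (rule ccontr)
      assume "induced E (insert v K) \<inter> induced E R \<noteq> {}"
      then obtain e where e: "e \<subseteq> insert v K \<inter> R" "e \<in> E" by (auto simp: induced_def)
      then have "card e = 2" using sg by (simp add: simple_graph_def)
      moreover have "card e \<le> card {v}" using e(1) unfolding i by (intro card_mono) auto
      ultimately show False by simp
    qed
    then show ?thesis
      unfolding P_def Q_def drawing_Int[OF emb ivK KR(2) induced_mono induced_mono sub] i by (simp add: drawing_def)
  qed
  have edge: "\<exists>a\<in>K0. \<exists>b\<in>R - {v}. e = {a, b} \<and> pathstart (h e) = pos a \<and> pathfinish (h e) = pos b
      \<and> path_image (h e) \<inter> P = {pos a} \<and> path_image (h e) \<inter> Q = {pos b}"
    if e: "e \<in> T" for e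
  proof -
    obtain a b where ab: "a \<in> K" "b \<in> R - {v}" "e = {a, b}" using e by (auto simp: T_def)
    have "a \<in> K0" using cross[of a b] ab eE(2)[OF e] by auto
    have im: "path_image (h e) = path_image (\<gamma> e)" by (simp add: h_def)
    have ends: "{pathstart (\<gamma> e), pathfinish (\<gamma> e)} = {pos a, pos b}" using D(3)[OF eE(2)[OF e]] ab(3) by simp
    have "pos b \<notin> pos ` K"
      using D(1) ab(2) KR by (metis DiffD1 disjoint_iff image_iff inj_onD subsetD)
    consider "pathstart (\<gamma> e) = pos a" "pathfinish (\<gamma> e) = pos b"
      | "pathstart (\<gamma> e) = pos b" "pathfinish (\<gamma> e) = pos a"
      using ends by (auto simp: doubleton_eq_iff)
    then have se: "pathstart (h e) = pos a \<and> pathfinish (h e) = pos b"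
    proof cases
      case 1
      then have "h e = \<gamma> e" using ab(1) by (simp add: h_def)
      then show ?thesis using 1 by simp
    next
      case 2
      then have "h e = reversepath (\<gamma> e)" using \<open>pos b \<notin> pos ` K\<close> by (simp add: h_def)
      then show ?thesis using 2 by simp
    qed
    have de: "path_image (h e) = drawing e {e} pos \<gamma>"
      using D(4)[OF eE(2)[OF e]] unfolding im by (auto simp: drawing_def)
    have eab: "e \<inter> insert v K = {a}" "e \<inter> R = {b}" using ab KR(5) by auto
    have ni: "{e} \<inter> induced E (insert v K) = {}" "{e} \<inter> induced E R = {}"
      using ab KR(5) by (auto simp: induced_def)
    have se1: "{e} \<subseteq> E" "\<Union>{e} \<subseteq> e" using eE(2)[OF e] by auto
    have "path_image (h e) \<inter> P = {pos a}" "path_image (h e) \<inter> Q = {pos b}"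
      unfolding de P_def Q_def
        drawing_Int[OF emb eE(1)[OF e] ivK se1(1) induced_mono se1(2) sub(1)]
        drawing_Int[OF emb eE(1)[OF e] KR(2) se1(1) induced_mono se1(2) sub(2)] eab ni
      by (simp_all add: drawing_def)
    then show ?thesis using \<open>a \<in> K0\<close> ab se by blast
  qed
  have posV: "pos ` V \<subseteq> P \<union> Q" using KR(6) by (auto simp: P_def Q_def drawing_def)
  have whole: "P \<union> Q \<union> (\<Union>g\<in>h ` T. path_image g) = drawing V E pos \<gamma>"
  proof -
    have "path_image (h e) = path_image (\<gamma> e)" for e by (simp add: h_def)
    then have him: "(\<Union>g\<in>h ` T. path_image g) = (\<Union>e\<in>T. path_image (\<gamma> e))" by simp
    have "E = induced E (insert v K) \<union> induced E R \<union> T"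
    proof
      show "E \<subseteq> induced E (insert v K) \<union> induced E R \<union> T"
      proof
        fix e assume e: "e \<in> E"
        then obtain a b where ab: "e = {a, b}" "a \<in> V" "b \<in> V" using simple_graph_edgeE[OF sg e] by metis
        have *: "e \<in> T" if "a \<in> K" "b \<in> R - {v}" "e = {a, b}" for a b
          using that e by (auto simp: T_def)
        have "e = {b, a}" using ab(1) by (simp add: insert_commute)
        then show "e \<in> induced E (insert v K) \<union> induced E R \<union> T"
          using e ab *[of a b] *[of b a] R(2) by (auto simp: induced_def K_def)
      qed
    qed (auto simp: induced_def T_def)
    moreover have "V = insert v K \<union> R" using KR(6) v(1) by auto
    ultimately show ?thesis unfolding him P_def Q_def drawing_def by (auto simp: image_Un)
  qed
  have vdist: "pos u \<noteq> pos v" if "u \<in> V" "u \<noteq> v" for u using D(1) that v(1) by (meson inj_onD)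
  obtain F1 F2 where F: "F1 \<noteq> F2"
    "\<And>F. F \<in> {F1, F2} \<Longrightarrow> F \<in> components (- (P \<union> Q \<union> (\<Union>g\<in>h ` T. path_image g))) \<and> pos v \<in> frontier F
       \<and> (\<exists>g\<in>h ` T. path_image g \<subseteq> frontier F)"
  proof (rule two_faces_at_cut_point[OF PQ PQv, of "h ` T"])
    show "finite (h ` T)" using fin(3) by (auto simp: T_def)
    show "h ` T \<noteq> {}" using \<open>T \<noteq> {}\<close> by simp
    fix g assume "g \<in> h ` T"
    then obtain e where e: "e \<in> T" "g = h e" by blast
    obtain a b where ab: "a \<in> K0" "b \<in> R - {v}" "pathstart g = pos a" "pathfinish g = pos b"
        "path_image g \<inter> P = {pos a}" "path_image g \<inter> Q = {pos b}" using edge[OF e(1)] e(2) by blast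
    show "arc g" using D(2)[OF eE(2)[OF e(1)]] unfolding e(2) h_def by (auto simp: arc_reversepath)
    show "pathstart g \<noteq> pos v" "pathfinish g \<noteq> pos v"
      using ab(1-4) vdist K0(1,3) KR(2) by auto
    show "path_image g \<inter> P = {pathstart g}" "path_image g \<inter> Q = {pathfinish g}" using ab by auto
    fix g' assume "g' \<in> h ` T" "g \<noteq> g'"
    then obtain e' where e': "e' \<in> T" "g' = h e'" "e \<noteq> e'" using e(2) by blast
    have "path_image g \<inter> path_image g' = pos ` (e \<inter> e')"
      using D(5)[OF eE(2)[OF e(1)] eE(2)[OF e'(1)] e'(3)] unfolding e(2) e'(2) h_def by auto
    then show "path_image g \<inter> path_image g' \<subseteq> P \<union> Q" using eE(1)[OF e(1)] posV by blast
  qed blast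
  have "F \<in> faces V E pos \<gamma> \<and> face_incident pos F v \<and>
      (\<exists>u \<in> V. u \<noteq> v \<and> face_incident pos F u \<and> 5 \<le> card (nbrs E u))" if F12: "F \<in> {F1, F2}" for F
  proof -
    obtain e where e: "e \<in> T" "path_image (h e) \<subseteq> frontier F" using F(2)[OF F12] by blast
    obtain a b where ab: "a \<in> K0" "b \<in> R - {v}" "e = {a, b}" "pathstart (h e) = pos a" "pathfinish (h e) = pos b"
      using edge[OF e(1)] by blast
    have fr: "pos a \<in> frontier F" "pos b \<in> frontier F"
      using e(2) ab(4,5) by (metis pathstart_in_path_image subsetD, metis pathfinish_in_path_image subsetD)
    have V: "a \<in> V" "b \<in> V - K0" "a \<noteq> v" "b \<noteq> v" using ab(1,2) K0(1,3) R(1) by auto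
    have "5 \<le> card (nbrs E a) \<or> 5 \<le> card (nbrs E b)"
      using large[OF ab(1) V(2)] eE(2)[OF e(1)] ab(3) by simp
    then have "\<exists>u \<in> V. u \<noteq> v \<and> face_incident pos F u \<and> 5 \<le> card (nbrs E u)"
      using fr V unfolding face_incident_def by blast
    then show ?thesis using F(2)[OF F12] unfolding whole by (simp add: faces_def face_incident_def)
  qed
  then show ?thesis using F(1) by blast
qed

end

theorem theorem3:
  fixes V :: "'a set" and E :: "'a set set"
    and pos :: "'a \<Rightarrow> complex" and \<gamma> :: "'a set \<Rightarrow> real \<Rightarrow> complex" and v :: 'a
  assumes "minimal_non_choosable_planar 4 V E"
    and "plane_embedding V E pos \<gamma>"
    and "v \<in> V" and "vdegree E v = 6"
  shows "\<exists>F\<^sub>1 \<in> faces V E pos \<gamma>. \<exists>F\<^sub>2 \<in> faces V E pos \<gamma>. F\<^sub>1 \<noteq> F\<^sub>2 \<and>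
           (\<forall>F \<in> {F\<^sub>1, F\<^sub>2}. face_incident pos F v \<and>
              2 \<le> card {u \<in> V. face_incident pos F u \<and> 5 \<le> vdegree E u})"
proof -
  have sg: "simple_graph V E" and "\<not> choosable 4 V E"
    using assms(1) by (auto simp: minimal_non_choosable_planar_def)
  then obtain L :: "'a \<Rightarrow> nat set" where L: "\<forall>v\<in>V. finite (L v) \<and> card (L v) = 4"
    "\<not> (\<exists>c. (\<forall>v\<in>V. c v \<in> L v) \<and> proper_coloring E c)"
    unfolding choosable_def by blast
  interpret bad_lists V E pos \<gamma> L
  proof
    have "induced E V = E" using sg by (auto simp: induced_def simple_graph_def)
    then show "\<not> list_coloring E L V c" for c
      using L(2) list_coloring_induced[OF sg] by metis
  qed (use assms L in auto)
  have deg: "vdegree E u = card (nbrs E u)" for u by (rule vdegree_nbrs[OF sg])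
  \<comment> \<open>The vertex \<open>v\<close>, having degree 6, is itself one of the two.\<close>
  have two: "2 \<le> card {u \<in> V. face_incident pos F u \<and> 5 \<le> vdegree E u}"
    if F: "face_incident pos F v" "\<exists>u \<in> V. u \<noteq> v \<and> face_incident pos F u \<and> 5 \<le> card (nbrs E u)" for F
  proof -
    obtain u where u: "u \<in> V" "u \<noteq> v" "face_incident pos F u" "5 \<le> vdegree E u" using F(2) deg by auto
    have "card {u, v} \<le> card {u \<in> V. face_incident pos F u \<and> 5 \<le> vdegree E u}"
      using u F(1) assms(3,4) finite_V by (intro card_mono) auto
    then show ?thesis using u(2) by simp
  qed
  show ?thesis
    using two_faces_with_large_vertices[OF assms(3)] assms(4) two unfolding deg by (smt (verit))
qed

end
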